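(* Let $\{u_i\}_{i\in I}\subset H_\lambda$ be a family and set $u:=\sup_{i\in I}u_i$, $S:=\{z\in\mathbb{C}^n:u(z)<+\infty\}$. The following are equivalent: (1) $\sup_{B^n}u<+\infty$; (2) $u^*\in H_\lambda$; (3) there is $a\in\mathbb{C}^n$ with $u^*(a)<+\infty$; (4) there is an open ball $B^n(a;r)$ with $\sup_{B^n(a;r)}u<+\infty$; (5) $S$ is not $\lambda$-pluripolar.
   Context: Fix $\lambda=(\lambda_1,\dots,\lambda_n)$ with $\lambda_1=1$, $\lambda_k>0$. $\Phi^X(z,t)=(z_1e^{-\lambda_1t},\dots,z_ne^{-\lambda_nt})$. $B^n(a;r)$ is the open Euclidean ball, $B^n=B^n(0;1)$. $H_\lambda$ is the set of nonconstant plurisubharmonic functions $u\ge0$ on $\mathbb{C}^n$ with $u(\Phi^X(z,t))=e^{-\operatorname{Re}t}u(z)$ for all $z\in\mathbb{C}^n$, $t\in\mathbb{C}$. A set $E\subset\mathbb{C}^n$ is $\lambda$-pluripolar if there is $v\in H_\lambda$ with $E\subset\{v=0\}$. $u^*(z)=\limsup_{w\to z}u(w)$ is the upper-semicontinuous regularization. *)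

theory Defs
  imports "HOL-Analysis.Analysis"
begin

definition Phi :: "real^'n \<Rightarrow> complex^'n \<Rightarrow> complex \<Rightarrow> complex^'n" where
  "Phi lam z t = (\<chi> k. z$k * exp (- (complex_of_real (lam$k)) * t))"

definition circle_mean :: "(complex^'n \<Rightarrow> ereal) \<Rightarrow> complex^'n \<Rightarrow> complex^'n \<Rightarrow> ereal" where
  "circle_mean u a b =
     ereal (1 / (2 * pi)) *
       (enn2ereal (\<integral>\<^sup>+ \<theta>\<in>{0..2*pi}. e2ennreal (max 0 (u (a + exp (\<i> * complex_of_real \<theta>) *s b))) \<partial>lborel)
      - enn2ereal (\<integral>\<^sup>+ \<theta>\<in>{0..2*pi}. e2ennreal (max 0 (- u (a + exp (\<i> * complex_of_real \<theta>) *s b))) \<partial>lborel))"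

definition psh :: "(complex^'n \<Rightarrow> ereal) \<Rightarrow> bool" where
  "psh u \<longleftrightarrow> (\<forall>z. u z < \<infinity>) \<and> (\<forall>z. Limsup (at z) u \<le> u z)
     \<and> (\<forall>a b. u a \<le> circle_mean u a b)"

definition H_lam :: "real^'n \<Rightarrow> (complex^'n \<Rightarrow> ereal) set" where
  "H_lam lam = {u. psh u \<and> (\<exists>z w. u z \<noteq> u w) \<and> (\<forall>z. 0 \<le> u z)
      \<and> (\<forall>z t. u (Phi lam z t) = ereal (exp (- Re t)) * u z)}"

definition lam_pluripolar :: "real^'n \<Rightarrow> (complex^'n) set \<Rightarrow> bool" where
  "lam_pluripolar lam E \<longleftrightarrow> (\<exists>v\<in>H_lam lam. E \<subseteq> {z. v z = 0})"

text \<open>Upper semicontinuous regularization u^*(z) = limsup_{w -> z} u(w) (w = z allowed).\<close>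
definition usc_reg :: "('a::topological_space \<Rightarrow> ereal) \<Rightarrow> 'a \<Rightarrow> ereal" where
  "usc_reg u z = Limsup (nhds z) u"

end

theory Submission
  imports
    Defs
    "HOL-Complex_Analysis.Cauchy_Integral_Formula"
    "HOL-Probability.Probability_Measure"
begin

text \<open>
  A member \<open>f\<close> of \<open>H_lam\<close> is logarithmically plurisubharmonic: \<open>exp (- Re P) f\<close> on a complex line is
  \<open>f\<close> on an entire curve along the flow \<open>Phi\<close>, so the maximum principle bounds \<open>f\<close> at the centre of a
  circle by every \<open>exp (Re P)\<close> that dominates it on the circle. Hence geometric means of total
  weight \<open>1\<close> stay in the class, and \<open>- ln f\<close> satisfies mean value inequalities on circles and balls.

  If the family is bounded on the unit ball, it is locally bounded by homogeneity, and its regularized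
  supremum inherits every property of its members because it is the least upper semicontinuous
  majorant. If it is unbounded there, choose \<open>u_j\<close> with maxima \<open>M_j \<ge> exp (2^(j+1))\<close>. Then
  \<open>v = \<Prod>j. (u_j / M_j) powr 2^-(j+1)\<close> vanishes wherever the family is bounded, but not identically: the
  integrals of \<open>- ln (u_j / M_j)\<close> over a fixed ball are bounded uniformly in \<open>j\<close>. Finally, a member
  vanishing on a ball vanishes identically, since \<open>- ln\<close> of it is not integrable there.
\<close>

section \<open>Upper semicontinuity\<close>

definition usc :: "('a::topological_space \<Rightarrow> 'b::order) \<Rightarrow> bool" where
  "usc f \<longleftrightarrow> (\<forall>z c. f z < c \<longrightarrow> (\<forall>\<^sub>F w in nhds z. f w < c))"

lemma uscI: "(\<And>z c. f z < c \<Longrightarrow> \<forall>\<^sub>F w in nhds z. f w < c) \<Longrightarrow> usc f"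
  by (simp add: usc_def)

lemma uscD: "usc f \<Longrightarrow> f z < c \<Longrightarrow> \<forall>\<^sub>F w in nhds z. f w < c"
  by (simp add: usc_def)

lemma usc_const: "usc (\<lambda>_. c)"
  by (simp add: usc_def)

lemma open_usc_less: "usc f \<Longrightarrow> open {z. f z < c}"
  by (subst open_subopen) (force simp: usc_def eventually_nhds)

lemma borel_measurable_usc: "usc (f :: _ \<Rightarrow> real) \<Longrightarrow> f \<in> borel_measurable borel"
  by (subst borel_measurable_iff_less) (simp add: borel_open open_usc_less)

lemma continuous_on_tendsto_nhds: "continuous_on UNIV g \<Longrightarrow> (g \<longlongrightarrow> g z) (nhds z)"
  by (simp add: continuous_on_def tendsto_at_iff_tendsto_nhds)

lemma usc_compose:
  assumes "usc f" "continuous_on UNIV g"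
  shows "usc (\<lambda>x. f (g x))"
proof (rule uscI)
  fix z c assume "f (g z) < c"
  then have "\<forall>\<^sub>F y in nhds (g z). f y < c"
    by (rule uscD[OF assms(1)])
  then show "\<forall>\<^sub>F w in nhds z. f (g w) < c"
    by (rule eventually_compose_filterlim) (rule continuous_on_tendsto_nhds[OF assms(2)])
qed

lemma usc_add_continuous:
  fixes f g :: "'a::topological_space \<Rightarrow> real"
  assumes "usc f" "continuous_on UNIV g"
  shows "usc (\<lambda>x. f x + g x)"
proof (rule uscI)
  fix z c assume "f z + g z < c"
  then obtain d where d: "d > 0" "(f z + d) + (g z + d) < c"
    using dense[of 0 "(c - f z - g z) / 2"] by (auto simp: field_simps)
  have "\<forall>\<^sub>F w in nhds z. g w < g z + d"
    using d(1) by (intro order_tendstoD(2)[OF continuous_on_tendsto_nhds[OF assms(2)]]) simp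
  moreover have "\<forall>\<^sub>F w in nhds z. f w < f z + d"
    using d(1) by (intro uscD[OF assms(1)]) auto
  ultimately show "\<forall>\<^sub>F w in nhds z. f w + g w < c"
    by eventually_elim (use d(2) in linarith)
qed

lemma usc_mult_nonneg:
  fixes f g :: "'a::topological_space \<Rightarrow> real"
  assumes "usc f" "usc g" "\<And>x. 0 \<le> f x" "\<And>x. 0 \<le> g x"
  shows "usc (\<lambda>x. f x * g x)"
proof (rule uscI)
  fix z c assume "f z * g z < c"
  moreover have "((\<lambda>e. (f z + e) * (g z + e)) \<longlongrightarrow> f z * g z) (at_right 0)"
    by (auto intro!: tendsto_eq_intros)
  ultimately have "\<forall>\<^sub>F e in at_right 0. (f z + e) * (g z + e) < c \<and> e > 0"
    using eventually_at_right_less[of "0::real"] by (intro eventually_conj order_tendstoD(2))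
  then obtain e where e: "(f z + e) * (g z + e) < c" "e > 0"
    by (auto dest: eventually_happens)
  have "\<forall>\<^sub>F w in nhds z. f w < f z + e" "\<forall>\<^sub>F w in nhds z. g w < g z + e"
    using e assms by (auto intro!: uscD)
  then show "\<forall>\<^sub>F w in nhds z. f w * g w < c"
  proof eventually_elim
    case (elim w)
    then have "f w * g w \<le> (f z + e) * (g z + e)"
      using assms(3,4) e(2) by (intro mult_mono) (auto intro: add_nonneg_nonneg)
    with e show ?case by linarith
  qed
qed

lemma usc_prod_nonneg:
  fixes f :: "'i \<Rightarrow> 'a::topological_space \<Rightarrow> real"
  assumes "\<And>i. i \<in> J \<Longrightarrow> usc (f i)" "\<And>i x. i \<in> J \<Longrightarrow> 0 \<le> f i x"
  shows "usc (\<lambda>x. \<Prod>i\<in>J. f i x)"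
  using assms
  by (induction J rule: infinite_finite_induct) (auto simp: usc_const usc_mult_nonneg prod_nonneg)

lemma usc_mono_continuous:
  fixes f :: "'a::topological_space \<Rightarrow> real" and \<phi> :: "real \<Rightarrow> 'b::linorder_topology"
  assumes f: "usc f" and \<phi>: "mono \<phi>" "continuous_on UNIV \<phi>"
  shows "usc (\<lambda>z. \<phi> (f z))"
proof (rule uscI)
  fix z c assume below: "\<phi> (f z) < c"
  have "(\<phi> \<longlongrightarrow> \<phi> (f z)) (at_right (f z))"
    using continuous_on_tendsto_nhds[OF \<phi>(2)] by (rule tendsto_mono[rotated]) (simp add: at_within_def)
  then have "\<forall>\<^sub>F y in at_right (f z). \<phi> y < c \<and> f z < y"
    using below eventually_at_right_less by (intro eventually_conj order_tendstoD(2))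
  then obtain y where y: "\<phi> y < c" "f z < y"
    by (auto dest: eventually_happens)
  from y(2) have "\<forall>\<^sub>F w in nhds z. f w < y" by (rule uscD[OF f])
  then show "\<forall>\<^sub>F w in nhds z. \<phi> (f w) < c"
  proof eventually_elim
    case (elim w)
    then have "\<phi> (f w) \<le> \<phi> y" using \<phi>(1) by (simp add: monoD)
    with y(1) show ?case by simp
  qed
qed

lemma usc_powr:
  fixes f :: "'a::topological_space \<Rightarrow> real"
  assumes "usc f" "\<And>x. 0 \<le> f x" "0 < \<alpha>"
  shows "usc (\<lambda>x. f x powr \<alpha>)"
proof -
  have "usc (\<lambda>x. max 0 (f x) powr \<alpha>)"
    using assms by (intro usc_mono_continuous[of f "\<lambda>y. max 0 y powr \<alpha>"] monoI powr_mono2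
        continuous_on_powr' continuous_intros) auto
  then show ?thesis using assms(2) by (simp add: max_absorb2)
qed

lemma usc_attains_sup:
  fixes f :: "'a::topological_space \<Rightarrow> 'b::linorder"
  assumes f: "usc f" and K: "compact K" "K \<noteq> {}"
  shows "\<exists>z\<in>K. \<forall>w\<in>K. f w \<le> f z"
proof (rule ccontr)
  assume "\<not> ?thesis"
  then have "K \<subseteq> (\<Union>w\<in>K. {x. f x < f w})" by (auto simp: not_le)
  then obtain D where D: "D \<subseteq> K" "finite D" "K \<subseteq> (\<Union>w\<in>D. {x. f x < f w})"
    using compactE_image[OF K(1), of K "\<lambda>w. {x. f x < f w}"] open_usc_less[OF f] by metis
  then have "D \<noteq> {}" using K by auto
  then have "Max (f ` D) \<in> f ` D" using D(2) by (intro Max_in) auto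
  then obtain w where "w \<in> D" "f w = Max (f ` D)" by auto
  then have "w \<in> D" "\<forall>x\<in>D. f x \<le> f w" using D(2) by auto
  with D show False by (force simp: not_less)
qed

lemma usc_bounded_on_compact:
  fixes f :: "'a::topological_space \<Rightarrow> 'b::linorder"
  assumes "usc f" "compact K"
  obtains M where "\<And>w. w \<in> K \<Longrightarrow> f w \<le> M"
  using usc_attains_sup[OF assms] by (cases "K = {}") auto

lemma usc_less_on_compact:
  fixes f :: "'a::topological_space \<Rightarrow> real"
  assumes "usc f" "compact C"
  obtains K where "K > 0" "\<And>z. z \<in> C \<Longrightarrow> f z < K"
proof -
  obtain M where M: "\<And>z. z \<in> C \<Longrightarrow> f z \<le> M"
    using usc_bounded_on_compact[OF assms] by blast
  show ?thesis
    by (rule that[of "\<bar>M\<bar> + 1"]) (use M in fastforce)+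
qed

lemma usc_finite_family_less_on_compact:
  fixes f :: "'i \<Rightarrow> 'a::topological_space \<Rightarrow> real"
  assumes J: "finite J" and f: "\<And>j. j \<in> J \<Longrightarrow> usc (f j)" and C: "compact C"
  obtains K where "K > 0" "\<And>j z. j \<in> J \<Longrightarrow> z \<in> C \<Longrightarrow> f j z < K"
proof -
  have "\<forall>\<^sub>F K in at_top. \<forall>j\<in>J. \<forall>z\<in>C. f j z < K"
  proof (rule eventually_ball_finite[OF J], rule ballI)
    fix j assume "j \<in> J"
    then obtain K where K: "\<And>z. z \<in> C \<Longrightarrow> f j z < K"
      using usc_less_on_compact[OF f C] by blast
    show "\<forall>\<^sub>F K in at_top. \<forall>z\<in>C. f j z < K"
      by (rule eventually_mono[OF eventually_ge_at_top[of K]]) (use K in \<open>auto intro: less_le_trans\<close>)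
  qed
  then have "\<forall>\<^sub>F K in at_top. 0 < K \<and> (\<forall>j\<in>J. \<forall>z\<in>C. f j z < K)"
    by (intro eventually_conj eventually_gt_at_top)
  from eventually_happens[OF this] show ?thesis using that by auto
qed

lemma usc_ereal_iff: "usc (\<lambda>z. ereal (f z)) \<longleftrightarrow> usc f"
proof
  assume f: "usc (\<lambda>z. ereal (f z))"
  show "usc f"
    by (rule uscI) (use uscD[OF f, of _ "ereal _"] in simp)
next
  assume "usc f"
  then show "usc (\<lambda>z. ereal (f z))"
    by (rule usc_mono_continuous) (auto intro!: monoI continuous_intros)
qed

lemma usc_imp_Limsup_le:
  fixes f :: "'a::topological_space \<Rightarrow> 'b::complete_linorder"
  assumes f: "usc f" and x: "(x \<longlongrightarrow> l) F"
  shows "Limsup F (\<lambda>n. f (x n)) \<le> f l"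
  unfolding Limsup_le_iff
  by (auto intro: eventually_compose_filterlim[OF uscD[OF f] x])

lemma usc_iff_Limsup_le:
  fixes f :: "'a::topological_space \<Rightarrow> 'b::complete_linorder"
  shows "usc f \<longleftrightarrow> (\<forall>z. Limsup (at z) f \<le> f z)"
  by (auto simp: usc_def Limsup_le_iff eventually_nhds_conv_at)

subsection \<open>The upper semicontinuous regularization\<close>

lemma le_usc_reg: "u z \<le> usc_reg u z"
proof (rule ccontr)
  assume "\<not> ?thesis"
  then have "\<forall>\<^sub>F w in nhds z. u w < u z"
    unfolding usc_reg_def by (intro Limsup_lessD) simp
  then show False using eventually_nhds_x_imp_x by fastforce
qed

lemma usc_usc_reg: "usc (usc_reg u)"
proof (rule uscI)
  fix z c assume "usc_reg u z < c"
  then obtain c' where c': "Limsup (nhds z) u < c'" "c' < c"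
    using dense by (auto simp: usc_reg_def)
  then have "\<forall>\<^sub>F y in nhds z. \<forall>\<^sub>F w in nhds y. u w < c'"
    by (simp only: eventually_eventually Limsup_lessD)
  then show "\<forall>\<^sub>F y in nhds z. usc_reg u y < c"
  proof eventually_elim
    case (elim y)
    then have "usc_reg u y \<le> c'"
      unfolding usc_reg_def by (intro Limsup_bounded) (auto elim: eventually_mono)
    with c'(2) show ?case by simp
  qed
qed

lemma usc_reg_least:
  assumes "usc m" "\<And>z. u z \<le> m z"
  shows "usc_reg u z \<le> m z"
  unfolding usc_reg_def Limsup_le_iff
proof (intro allI impI)
  fix y assume "m z < y"
  then have "\<forall>\<^sub>F w in nhds z. m w < y" by (rule uscD[OF assms(1)])
  then show "\<forall>\<^sub>F w in nhds z. u w < y"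
    by (rule eventually_mono) (rule le_less_trans[OF assms(2)])
qed

lemma usc_reg_less_top_iff:
  fixes u :: "'a::metric_space \<Rightarrow> ereal"
  shows "usc_reg u a < \<infinity> \<longleftrightarrow> (\<exists>r>0. (SUP z\<in>ball a r. u z) < \<infinity>)"
proof
  assume "usc_reg u a < \<infinity>"
  then obtain c where c: "usc_reg u a < c" "c < \<infinity>"
    using dense by blast
  then have "\<forall>\<^sub>F w in nhds a. u w < c"
    by (simp add: usc_reg_def Limsup_lessD)
  then obtain r where "r > 0" "\<And>w. dist w a < r \<Longrightarrow> u w < c"
    unfolding eventually_nhds_metric by blast
  then have "(SUP z\<in>ball a r. u z) \<le> c"
    by (intro SUP_least less_imp_le) (simp add: dist_commute)
  with \<open>r > 0\<close> c(2) show "\<exists>r>0. (SUP z\<in>ball a r. u z) < \<infinity>"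
    using le_less_trans by blast
next
  assume "\<exists>r>0. (SUP z\<in>ball a r. u z) < \<infinity>"
  then obtain r where r: "r > 0" "(SUP z\<in>ball a r. u z) < \<infinity>" by blast
  have "\<forall>\<^sub>F w in nhds a. w \<in> ball a r"
    using r(1) by (intro eventually_nhds_in_open) auto
  then have "usc_reg u a \<le> (SUP z\<in>ball a r. u z)"
    unfolding usc_reg_def by (intro Limsup_bounded) (auto elim!: eventually_mono intro: SUP_upper)
  with r(2) show "usc_reg u a < \<infinity>" using le_less_trans by blast
qed

lemma
  fixes f :: "'i \<Rightarrow> 'a::topological_space \<Rightarrow> real"
  assumes h: "usc_reg (\<lambda>z. SUP i\<in>I. ereal (f i z)) = (\<lambda>z. ereal (h z))"
  shows usc_reg_SUP_ereal_usc: "usc h"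
    and usc_reg_SUP_ereal_upper: "i \<in> I \<Longrightarrow> f i z \<le> h z"
    and usc_reg_SUP_ereal_least: "usc m \<Longrightarrow> (\<And>i z. i \<in> I \<Longrightarrow> f i z \<le> m z) \<Longrightarrow> h z \<le> m z"
proof -
  let ?u = "\<lambda>z. SUP i\<in>I. ereal (f i z)"
  show "usc h"
    using usc_usc_reg[of ?u] by (simp add: h usc_ereal_iff)
  show "f i z \<le> h z" if "i \<in> I"
  proof -
    have "ereal (f i z) \<le> ?u z" using that by (rule SUP_upper)
    also have "\<dots> \<le> ereal (h z)" using le_usc_reg[of ?u z] by (simp add: h)
    finally show ?thesis by simp
  qed
  show "h z \<le> m z" if "usc m" "\<And>i z. i \<in> I \<Longrightarrow> f i z \<le> m z"
  proof -
    have "usc_reg ?u z \<le> ereal (m z)"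
      by (rule usc_reg_least) (auto simp: usc_ereal_iff that intro: SUP_least)
    then show ?thesis by (simp add: h)
  qed
qed

section \<open>Circle averages\<close>

definition uniform_angle :: "real measure" where
  "uniform_angle = uniform_measure lborel {0..2*pi}"

lemma space_uniform_angle [simp]: "space uniform_angle = UNIV"
  and sets_uniform_angle [simp, measurable_cong]: "sets uniform_angle = sets borel"
  by (simp_all add: uniform_angle_def)

interpretation uniform_angle: prob_space uniform_angle
  unfolding uniform_angle_def by (rule prob_space_uniform_measure) auto

lemma integrable_uniform_angle_bounded:
  fixes f :: "real \<Rightarrow> 'a::{banach,second_countable_topology}"
  assumes "f \<in> borel_measurable borel" "\<And>x. norm (f x) \<le> B"
  shows "integrable uniform_angle f"
  by (rule uniform_angle.integrable_const_bound[of _ B]) (use assms in auto)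

lemma integral_uniform_angle:
  fixes f :: "real \<Rightarrow> 'a::{banach,second_countable_topology}"
  assumes "f \<in> borel_measurable borel"
  shows "(\<integral>\<theta>. f \<theta> \<partial>uniform_angle) = (LINT \<theta>:{0..2*pi}|lborel. f \<theta>) /\<^sub>R (2 * pi)"
proof -
  have density: "uniform_angle = density lborel (\<lambda>x. ennreal (indicator {0..2*pi} x / (2*pi)))"
    unfolding uniform_angle_def uniform_measure_def
    by (rule density_cong) (auto simp: indicator_def divide_ennreal simp flip: ennreal_1)
  have "(\<integral>\<theta>. f \<theta> \<partial>uniform_angle) = (\<integral>\<theta>. (indicator {0..2*pi} \<theta> / (2*pi)) *\<^sub>R f \<theta> \<partial>lborel)"
    unfolding density using assms by (subst integral_density) auto
  also have "\<dots> = (\<integral>\<theta>. (1 / (2*pi)) *\<^sub>R (indicator {0..2*pi} \<theta> *\<^sub>R f \<theta>) \<partial>lborel)"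
    by (simp add: field_simps)
  also have "\<dots> = (LINT \<theta>:{0..2*pi}|lborel. f \<theta>) /\<^sub>R (2 * pi)"
    unfolding set_lebesgue_integral_def by (subst integral_scaleR_right) (simp add: field_simps)
  finally show ?thesis .
qed

lemma circle_integrable:
  fixes g :: "complex \<Rightarrow> 'a::{banach,second_countable_topology}"
  assumes g: "continuous_on (sphere z r) g" and r: "0 \<le> r"
  shows circle_borel_measurable: "(\<lambda>\<theta>. g (z + of_real r * cis \<theta>)) \<in> borel_measurable borel"
    and "integrable uniform_angle (\<lambda>\<theta>. g (z + of_real r * cis \<theta>))"
proof -
  have on_sphere: "z + of_real r * cis \<theta> \<in> sphere z r" for \<theta>
    using r by (simp add: dist_norm norm_mult)
  have "continuous_on UNIV (\<lambda>\<theta>. g (z + of_real r * cis \<theta>))"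
    by (rule continuous_on_compose2[OF g]) (use on_sphere in \<open>auto intro!: continuous_intros\<close>)
  then show meas: "(\<lambda>\<theta>. g (z + of_real r * cis \<theta>)) \<in> borel_measurable borel"
    by (rule borel_measurable_continuous_onI)
  have "bounded (g ` sphere z r)"
    by (intro compact_imp_bounded compact_continuous_image g compact_sphere)
  then obtain B where "\<forall>x\<in>g ` sphere z r. norm x \<le> B"
    unfolding bounded_iff by blast
  then show "integrable uniform_angle (\<lambda>\<theta>. g (z + of_real r * cis \<theta>))"
    using meas on_sphere by (intro integrable_uniform_angle_bounded[of _ B]) auto
qed

lemma holomorphic_mean_value:
  assumes P: "P holomorphic_on cball z r" and r: "0 < r"
  shows "integrable uniform_angle (\<lambda>\<theta>. P (z + of_real r * cis \<theta>))"
    and "(\<integral>\<theta>. P (z + of_real r * cis \<theta>) \<partial>uniform_angle) = P z"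
proof -
  let ?c = "\<lambda>\<theta>. z + of_real r * cis \<theta>"
  have P_cont: "continuous_on (sphere z r) P"
    using holomorphic_on_imp_continuous_on[OF P] continuous_on_subset sphere_cball by blast
  show "integrable uniform_angle (\<lambda>\<theta>. P (?c \<theta>))"
    using circle_integrable[OF P_cont] r by simp
  have "((\<lambda>u. P u / (u - z)) has_contour_integral (2 * of_real pi * \<i> * P z)) (part_circlepath z r 0 (2*pi))"
    using Cauchy_integral_circlepath_simple[OF P, of z] r by (simp add: circlepath_def)
  then have "((\<lambda>\<theta>. P (?c \<theta>) / (r * cis \<theta>) * r * \<i> * cis \<theta>) has_integral (2 * of_real pi * \<i> * P z)) {0..2*pi}"
    by (subst (asm) has_contour_integral_part_circlepath_iff) auto
  also have "(\<lambda>\<theta>. P (?c \<theta>) / (r * cis \<theta>) * r * \<i> * cis \<theta>) = (\<lambda>\<theta>. \<i> * P (?c \<theta>))"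
    using r by (auto simp: fun_eq_iff)
  finally have "((\<lambda>\<theta>. (- \<i>) * (\<i> * P (?c \<theta>))) has_integral ((- \<i>) * (2 * of_real pi * \<i> * P z))) {0..2*pi}"
    by (rule has_integral_mult_right)
  then have "((\<lambda>\<theta>. P (?c \<theta>)) has_integral (2 * of_real pi * P z)) {0..2*pi}"
    by (simp add: mult.assoc[symmetric]) (simp add: mult.assoc mult.left_commute)
  moreover have "set_integrable lborel {0..2*pi} (\<lambda>\<theta>. P (?c \<theta>))"
  proof (rule borel_integrable_compact[unfolded set_integrable_def[symmetric]])
    show "continuous_on {0..2*pi} (\<lambda>\<theta>. P (?c \<theta>))"
      by (rule continuous_on_compose2[OF P_cont])
         (use r in \<open>auto intro!: continuous_intros simp: dist_norm norm_mult\<close>)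
  qed simp
  ultimately have "(LINT \<theta>:{0..2*pi}|lborel. P (?c \<theta>)) = 2 * of_real pi * P z"
    using set_borel_integral_eq_integral(2) integral_unique by metis
  then show "(\<integral>\<theta>. P (?c \<theta>) \<partial>uniform_angle) = P z"
    using circle_borel_measurable[OF P_cont] r by (simp add: integral_uniform_angle scaleR_conv_of_real)
qed

lemma continuous_on_vector_smult [continuous_intros]:
  fixes c :: "'a::topological_space \<Rightarrow> complex" and x :: "'a \<Rightarrow> complex^'n"
  assumes "continuous_on A c" "continuous_on A x"
  shows "continuous_on A (\<lambda>t. c t *s x t)"
  unfolding vector_scalar_mult_def
  by (intro continuous_intros continuous_on_vec_lambda assms)

lemma norm_vector_smult: "norm (c *s (x::complex^'n)) = cmod c * norm x"
  by (simp add: norm_vec_def norm_mult L2_set_right_distrib)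

lemma circle_in_cball: "a + cis \<theta> *s (b::complex^'n) \<in> cball 0 (norm a + norm b)"
  using norm_triangle_ineq[of a "cis \<theta> *s b"] by (simp add: norm_vector_smult)

definition circle_average :: "(complex^'n \<Rightarrow> real) \<Rightarrow> complex^'n \<Rightarrow> complex^'n \<Rightarrow> real" where
  "circle_average f a b = (\<integral>\<theta>. f (a + cis \<theta> *s b) \<partial>uniform_angle)"

lemma usc_circle_measurable:
  fixes f :: "complex^'n \<Rightarrow> real"
  assumes "usc f"
  shows "(\<lambda>\<theta>. f (a + cis \<theta> *s b)) \<in> borel_measurable borel"
  by (rule borel_measurable_usc[OF usc_compose[OF assms]]) (intro continuous_intros)

lemma usc_circle_bounded:
  fixes f :: "complex^'n \<Rightarrow> real"
  assumes "usc f"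
  obtains M where "\<And>\<theta>. f (a + cis \<theta> *s b) \<le> M"
  using usc_bounded_on_compact[OF assms compact_cball] circle_in_cball by metis

lemma usc_circle_integrable:
  fixes f :: "complex^'n \<Rightarrow> real"
  assumes "usc f" "\<And>z. 0 \<le> f z"
  shows "integrable uniform_angle (\<lambda>\<theta>. f (a + cis \<theta> *s b))"
proof -
  obtain M where "\<And>\<theta>. f (a + cis \<theta> *s b) \<le> M" using usc_circle_bounded[OF assms(1)] by blast
  then show ?thesis
    using assms by (intro integrable_uniform_angle_bounded[of _ M] usc_circle_measurable) auto
qed

lemma circle_average_mono:
  assumes "usc f" "\<And>z. 0 \<le> f z" "usc g" "\<And>z. f z \<le> g z"
  shows "circle_average f a b \<le> circle_average g a b"
  unfolding circle_average_def
  by (intro integral_mono usc_circle_integrable assms order_trans[OF assms(2,4)])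

lemma nn_integral_circle:
  assumes "usc f" "\<And>z. 0 \<le> f z"
  shows "(\<integral>\<^sup>+\<theta>. ennreal (f (a + cis \<theta> *s b)) \<partial>uniform_angle) = ennreal (circle_average f a b)"
  unfolding circle_average_def
  by (intro nn_integral_eq_integral usc_circle_integrable assms) (simp add: assms)

lemma usc_circle_average:
  fixes f :: "complex^'n \<Rightarrow> real"
  assumes f: "usc f" "\<And>z. 0 \<le> f z"
  shows "usc (\<lambda>a. circle_average f a b)"
proof (rule uscI)
  fix a c assume below: "circle_average f a b < c"
  show "\<forall>\<^sub>F w in nhds a. circle_average f w b < c"
    unfolding eventually_nhds_iff_sequentially
  proof (intro allI impI)
    fix w :: "nat \<Rightarrow> complex^'n" assume w: "w \<longlonglongrightarrow> a"
    obtain R where R: "\<And>n. norm (w n) \<le> R"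
      using convergent_imp_Bseq[OF convergentI[OF w]] by (auto simp: Bseq_def)
    obtain M where M: "\<And>z. z \<in> cball 0 (R + norm b) \<Longrightarrow> f z \<le> M"
      using usc_bounded_on_compact[OF f(1) compact_cball] by blast
    have f_le: "f (w n + cis \<theta> *s b) \<le> M" for n \<theta>
      using circle_in_cball[of "w n" \<theta> b] R[of n] by (intro M) auto
    have "limsup (\<lambda>n. \<integral>\<^sup>+\<theta>. ennreal (f (w n + cis \<theta> *s b)) \<partial>uniform_angle)
        \<le> (\<integral>\<^sup>+\<theta>. limsup (\<lambda>n. ennreal (f (w n + cis \<theta> *s b))) \<partial>uniform_angle)"
      using usc_circle_measurable[OF f(1)] f_le
      by (intro nn_integral_limsup[where w = "\<lambda>_. ennreal M"])
        (auto intro!: ennreal_leI simp: uniform_angle.emeasure_space_1[simplified])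
    also have "\<dots> \<le> (\<integral>\<^sup>+\<theta>. ennreal (f (a + cis \<theta> *s b)) \<partial>uniform_angle)"
    proof (intro nn_integral_mono usc_imp_Limsup_le[where f = "\<lambda>z. ennreal (f z)"])
      show "usc (\<lambda>z. ennreal (f z))"
        by (rule usc_mono_continuous[OF f(1)])
           (auto intro!: monoI ennreal_leI continuous_on_ennreal continuous_on_id)
    qed (intro tendsto_intros w)
    also have "\<dots> < ennreal c"
      using below f by (simp add: nn_integral_circle ennreal_less_iff circle_average_def)
    finally have "\<forall>\<^sub>F n in sequentially. ennreal (circle_average f (w n) b) < ennreal c"
      by (intro Limsup_lessD) (simp add: nn_integral_circle f)
    then show "\<forall>\<^sub>F n in sequentially. circle_average f (w n) b < c"
      by eventually_elim (use f(2) in \<open>simp add: ennreal_less_iff circle_average_def\<close>)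
  qed
qed

lemma circle_mean_ereal:
  fixes f :: "complex^'n \<Rightarrow> real"
  assumes f: "usc f" "\<And>z. 0 \<le> f z"
  shows "circle_mean (\<lambda>z. ereal (f z)) a b = ereal (circle_average f a b)"
proof -
  let ?h = "\<lambda>\<theta>. f (a + cis \<theta> *s b)"
  have meas: "?h \<in> borel_measurable borel" by (rule usc_circle_measurable[OF f(1)])
  obtain M where M: "\<And>\<theta>. ?h \<theta> \<le> M" using usc_circle_bounded[OF f(1)] by blast
  have int: "integrable lborel (\<lambda>\<theta>. indicator {0..2*pi} \<theta> *\<^sub>R ?h \<theta>)"
    by (rule integrableI_bounded_set_indicator[where B = M]) (use meas M f(2) in auto)
  have "(\<integral>\<^sup>+\<theta>\<in>{0..2*pi}. ennreal (?h \<theta>) \<partial>lborel) = (\<integral>\<^sup>+\<theta>. ennreal (indicator {0..2*pi} \<theta> *\<^sub>R ?h \<theta>) \<partial>lborel)"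
    by (intro nn_integral_cong) (auto simp: indicator_def)
  also have "\<dots> = ennreal (LINT \<theta>:{0..2*pi}|lborel. ?h \<theta>)"
    unfolding set_lebesgue_integral_def using f(2) by (intro nn_integral_eq_integral[OF int]) auto
  also have "(LINT \<theta>:{0..2*pi}|lborel. ?h \<theta>) = 2 * pi * circle_average f a b"
    by (simp add: circle_average_def integral_uniform_angle[OF meas])
  finally have positive_part:
    "(\<integral>\<^sup>+\<theta>\<in>{0..2*pi}. ennreal (?h \<theta>) \<partial>lborel) = ennreal (2 * pi * circle_average f a b)" .
  have max_0: "e2ennreal (max 0 (ereal (f z))) = ennreal (f z)" "e2ennreal (max 0 (- ereal (f z))) = 0" for z
    using f(2)[of z] by (simp_all add: max_def zero_ereal_def)
  have "0 \<le> circle_average f a b" using f(2) by (simp add: circle_average_def)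
  then show ?thesis
    unfolding circle_mean_def cis_conv_exp[symmetric] max_0 positive_part
    by (simp add: enn2ereal_ennreal zero_ennreal.rep_eq)
qed

section \<open>Nonnegative plurisubharmonic functions\<close>

definition nonneg_psh :: "(complex^'n \<Rightarrow> real) \<Rightarrow> bool" where
  "nonneg_psh f \<longleftrightarrow> (\<forall>z. 0 \<le> f z) \<and> usc f \<and> (\<forall>a b. f a \<le> circle_average f a b)"

lemma nonneg_pshD:
  assumes "nonneg_psh f"
  shows nonneg_psh_nonneg: "0 \<le> f z"
    and nonneg_psh_usc: "usc f"
    and nonneg_psh_le_circle_average: "f a \<le> circle_average f a b"
  using assms by (auto simp: nonneg_psh_def)

lemma psh_ereal_iff:
  assumes "\<And>z. 0 \<le> f z"
  shows "psh (\<lambda>z. ereal (f z)) \<longleftrightarrow> nonneg_psh f"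
proof -
  have "(\<forall>z. Limsup (at z) (\<lambda>w. ereal (f w)) \<le> ereal (f z)) \<longleftrightarrow> usc f"
    by (simp add: usc_ereal_iff flip: usc_iff_Limsup_le)
  then show ?thesis
    using assms by (auto simp: psh_def nonneg_psh_def circle_mean_ereal)
qed

lemma nonneg_psh_cmult:
  assumes f: "nonneg_psh f" and c: "0 \<le> c"
  shows "nonneg_psh (\<lambda>z. c * f z)"
  unfolding nonneg_psh_def
proof (intro conjI allI)
  show "usc (\<lambda>z. c * f z)"
    using nonneg_pshD[OF f] c by (intro usc_mult_nonneg usc_const) auto
  show "c * f a \<le> circle_average (\<lambda>z. c * f z) a b" for a b
    using nonneg_pshD(3)[OF f] c by (simp add: circle_average_def mult_left_mono)
qed (use nonneg_pshD(1)[OF f] c in auto)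

lemma nonneg_psh_decreasing_limit:
  fixes V :: "nat \<Rightarrow> complex^'n \<Rightarrow> real"
  assumes V: "\<And>m. nonneg_psh (V m)" "\<And>z. decseq (\<lambda>m. V m z)" "\<And>z. (\<lambda>m. V m z) \<longlonglongrightarrow> v z"
  shows "nonneg_psh v"
proof -
  have v_le: "v z \<le> V m z" for m z
    using V(2,3) by (rule decseq_ge)
  have nonneg: "0 \<le> v z" for z
    by (rule LIMSEQ_le_const[OF V(3)]) (simp add: nonneg_psh_nonneg V(1))
  have usc: "usc v"
  proof (rule uscI)
    fix z c assume "v z < c"
    with V(3) have "\<forall>\<^sub>F m in sequentially. V m z < c" by (rule order_tendstoD)
    then obtain m where "V m z < c" by (auto dest: eventually_happens)
    then have "\<forall>\<^sub>F w in nhds z. V m w < c" by (rule uscD[OF nonneg_psh_usc[OF V(1)]])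
    then show "\<forall>\<^sub>F w in nhds z. v w < c" by (rule eventually_mono) (rule le_less_trans[OF v_le])
  qed
  have "v a \<le> circle_average v a b" for a b
  proof (rule LIMSEQ_le[OF V(3)])
    show "(\<lambda>m. circle_average (V m) a b) \<longlonglongrightarrow> circle_average v a b"
      unfolding circle_average_def
    proof (rule integral_dominated_convergence)
      show "AE \<theta> in uniform_angle. norm (V m (a + cis \<theta> *s b)) \<le> V 0 (a + cis \<theta> *s b)" for m
        using decseqD[OF V(2), of 0 m] nonneg_psh_nonneg[OF V(1)] by simp
    qed (use usc_circle_measurable[OF usc] usc_circle_measurable[OF nonneg_psh_usc[OF V(1)]] in
        \<open>auto intro!: usc_circle_integrable V(3) nonneg_psh_usc nonneg_psh_nonneg V(1)\<close>)
  qed (use nonneg_psh_le_circle_average[OF V(1)] in auto)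
  with nonneg usc show ?thesis by (simp add: nonneg_psh_def)
qed

section \<open>The maximum principle along entire curves\<close>

lemma nonneg_psh_le_Re_holomorphic:
  assumes f: "nonneg_psh f" and Q: "Q holomorphic_on cball 0 1"
    and circle_le: "\<And>\<theta>. f (a + cis \<theta> *s b) \<le> Re (Q (cis \<theta>))"
  shows "f a \<le> Re (Q 0)"
proof -
  note mean = holomorphic_mean_value[OF Q, simplified]
  have "f a \<le> circle_average f a b" by (rule nonneg_psh_le_circle_average[OF f])
  also have "\<dots> \<le> (\<integral>\<theta>. Re (Q (cis \<theta>)) \<partial>uniform_angle)"
    unfolding circle_average_def
    by (intro integral_mono usc_circle_integrable nonneg_pshD[OF f] integrable_Re mean circle_le)
  also have "\<dots> = Re (Q 0)"
    using integral_Re[OF mean(1)] by (simp add: mean)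
  finally show ?thesis .
qed

lemma usc_less_near_compact:
  fixes f :: "'a::metric_space \<Rightarrow> 'b::order"
  assumes f: "usc f" and S: "compact S" and less: "\<And>x. x \<in> S \<Longrightarrow> f x < c"
  obtains e where "e > 0" "\<And>x y. x \<in> S \<Longrightarrow> dist x y < e \<Longrightarrow> f y < c"
proof -
  obtain e where "e > 0" "(\<Union>x\<in>S. ball x e) \<subseteq> {z. f z < c}"
    by (rule compact_subset_open_imp_ball_epsilon_subset[OF S open_usc_less[OF f]]) (use less in auto)
  then show ?thesis by (intro that[of e]) (auto simp: subset_iff)
qed

definition penalized ::
  "('a::real_normed_vector \<Rightarrow> real) \<Rightarrow> ('b::real_normed_vector \<Rightarrow> 'a) \<Rightarrow> real \<Rightarrow> real \<Rightarrow> 'a \<times> 'b \<Rightarrow> real" where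
  "penalized f F \<epsilon> N = (\<lambda>(z, \<zeta>). f z + (\<epsilon> * (norm \<zeta>)\<^sup>2 - N * (norm (z - F \<zeta>))\<^sup>2))"

lemma usc_penalized:
  fixes F :: "'b::real_normed_vector \<Rightarrow> 'a::real_normed_vector"
  assumes "usc f" "continuous_on UNIV F"
  shows "usc (penalized f F \<epsilon> N)"
  unfolding penalized_def case_prod_beta
  by (intro usc_add_continuous usc_compose[OF assms(1)] continuous_intros continuous_on_compose2[OF assms(2)])
     auto

lemma penalized_maximizer_near_curve:
  assumes large: "f (F 0) \<le> penalized f F \<epsilon> N (z0, \<zeta>0)" and unit: "norm \<zeta>0 \<le> 1"
    and bound: "f z0 \<le> A" "A + \<epsilon> - f (F 0) < N * e\<^sup>2" and pos: "0 < \<epsilon>" "0 < N" "0 < e"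
    and boundary: "\<And>\<zeta> z. norm \<zeta> = 1 \<Longrightarrow> dist (F \<zeta>) z < e \<Longrightarrow> f z < f (F 0) - \<epsilon>"
  shows "norm (z0 - F \<zeta>0) < e" and "norm \<zeta>0 < 1"
proof -
  have "\<epsilon> * (norm \<zeta>0)\<^sup>2 \<le> \<epsilon>" using unit pos(1) by (simp add: mult_left_le power_le_one)
  then have "N * (norm (z0 - F \<zeta>0))\<^sup>2 < N * e\<^sup>2" using large bound by (simp add: penalized_def)
  then show near: "norm (z0 - F \<zeta>0) < e" using pos by (simp add: power2_less_imp_less)
  have "norm \<zeta>0 \<noteq> 1"
  proof
    assume norm_1: "norm \<zeta>0 = 1"
    then have "f z0 < f (F 0) - \<epsilon>"
      using boundary[of \<zeta>0 z0] near by (simp add: dist_norm norm_minus_commute)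
    moreover have "0 \<le> N * (norm (z0 - F \<zeta>0))\<^sup>2" using pos(2) by simp
    ultimately show False using large norm_1 by (simp add: penalized_def)
  qed
  with unit show "norm \<zeta>0 < 1" by simp
qed

text \<open>Doubling of variables: \<open>z\<close> and \<open>\<zeta>\<close> vary independently, and a large \<open>N\<close> ties \<open>z\<close> to \<open>F \<zeta>\<close>.\<close>

lemma penalized_local_max:
  fixes f :: "'a::euclidean_space \<Rightarrow> real" and F :: "'b::euclidean_space \<Rightarrow> 'a"
  assumes f: "usc f" and F: "continuous_on UNIV F"
    and bound: "\<And>\<zeta>. norm \<zeta> = 1 \<Longrightarrow> f (F \<zeta>) \<le> c" and greater: "c < f (F 0)"
  obtains \<epsilon> N z0 \<zeta>0 where "\<epsilon> > 0" "N > 0"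
    "\<forall>\<^sub>F p in nhds (z0, \<zeta>0). penalized f F \<epsilon> N p \<le> penalized f F \<epsilon> N (z0, \<zeta>0)"
proof -
  define \<epsilon> where "\<epsilon> = (f (F 0) - c) / 2"
  have \<epsilon>: "\<epsilon> > 0" "c < f (F 0) - \<epsilon>" using greater by (auto simp: \<epsilon>_def field_simps)
  have F_compact: "compact (F ` C)" if "compact C" for C
    using that continuous_on_subset[OF F] by (intro compact_continuous_image) auto
  have "f x < f (F 0) - \<epsilon>" if "x \<in> F ` sphere 0 1" for x
    using that le_less_trans[OF bound \<epsilon>(2)] by auto
  then obtain e where e: "e > 0" "\<And>\<zeta> z. norm \<zeta> = 1 \<Longrightarrow> dist (F \<zeta>) z < e \<Longrightarrow> f z < f (F 0) - \<epsilon>"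
    using usc_less_near_compact[OF f F_compact[OF compact_sphere]] by (metis image_eqI mem_sphere_0)
  obtain \<rho> where "\<forall>x\<in>F ` cball 0 1. norm x \<le> \<rho>"
    using compact_imp_bounded[OF F_compact[OF compact_cball]] unfolding bounded_iff by blast
  then have \<rho>: "norm (F \<zeta>) \<le> \<rho>" if "norm \<zeta> \<le> 1" for \<zeta> using that by simp
  let ?K = "cball (0::'a) (\<rho> + e) \<times> cball (0::'b) 1"
  obtain A where A: "\<And>z. z \<in> cball 0 (\<rho> + e) \<Longrightarrow> f z \<le> A"
    using usc_bounded_on_compact[OF f compact_cball] by metis
  define N where "N = (\<bar>A + \<epsilon> - f (F 0)\<bar> + 1) / e\<^sup>2"
  have N: "N > 0" "A + \<epsilon> - f (F 0) < N * e\<^sup>2" using e(1) by (auto simp: N_def)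
  have start: "(F 0, 0) \<in> ?K" using \<rho>[of 0] e(1) by auto
  have "\<exists>p\<in>?K. \<forall>q\<in>?K. penalized f F \<epsilon> N q \<le> penalized f F \<epsilon> N p"
    using start by (intro usc_attains_sup usc_penalized f F compact_Times compact_cball) blast
  then obtain z0 \<zeta>0 where K: "norm z0 \<le> \<rho> + e" "norm \<zeta>0 \<le> 1"
    and max: "\<And>q. q \<in> ?K \<Longrightarrow> penalized f F \<epsilon> N q \<le> penalized f F \<epsilon> N (z0, \<zeta>0)" by auto
  have large: "f (F 0) \<le> penalized f F \<epsilon> N (z0, \<zeta>0)"
    using max[OF start] by (simp add: penalized_def)
  have "f z0 \<le> A" using A K(1) by simp
  from penalized_maximizer_near_curve[OF large K(2) this N(2) \<epsilon>(1) N(1) e(1)] e(2)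
  have "norm (z0 - F \<zeta>0) < e" "norm \<zeta>0 < 1" by blast+
  then have "(z0, \<zeta>0) \<in> ball 0 (\<rho> + e) \<times> ball 0 1"
    using \<rho>[of \<zeta>0] norm_triangle_ineq[of "z0 - F \<zeta>0" "F \<zeta>0"] by simp
  then have "\<forall>\<^sub>F p in nhds (z0, \<zeta>0). p \<in> ball 0 (\<rho> + e) \<times> ball 0 1"
    by (intro eventually_nhds_in_open open_Times open_ball)
  then have "\<forall>\<^sub>F p in nhds (z0, \<zeta>0). penalized f F \<epsilon> N p \<le> penalized f F \<epsilon> N (z0, \<zeta>0)"
    by (rule eventually_mono) (auto intro!: max)
  with \<epsilon>(1) N(1) show ?thesis by (rule that)
qed

lemma has_derivative_vec_holomorphic:
  fixes F :: "complex \<Rightarrow> complex^'n"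
  assumes "\<And>k. ((\<lambda>\<zeta>. F \<zeta> $ k) has_field_derivative w $ k) (at \<zeta>)"
  shows "(F has_derivative (\<lambda>\<eta>. \<eta> *s w)) (at \<zeta>)"
  using has_derivative_inner_left[OF has_field_derivative_imp_has_derivative[OF assms]]
  by (subst has_derivative_componentwise_within) (auto simp: Basis_vec_def inner_axis mult.commute)

lemma penalized_le_along_tangent:
  fixes F :: "complex \<Rightarrow> complex^'n" and z0 w :: "complex^'n" and \<zeta>0 :: complex
  defines "d \<equiv> z0 - F \<zeta>0" and "R \<equiv> \<lambda>\<eta>. F (\<zeta>0 + \<eta>) - F \<zeta>0 - \<eta> *s w"
  assumes tangent_le: "penalized f F \<epsilon> N (z0 + \<eta> *s w, \<zeta>0 + \<eta>) \<le> penalized f F \<epsilon> N (z0, \<zeta>0)"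
  shows "f (z0 + \<eta> *s w) \<le> f z0 - 2 * (\<epsilon> * (\<zeta>0 \<bullet> \<eta>) + N * (d \<bullet> R \<eta>))
    + (N * (norm (R \<eta>))\<^sup>2 - \<epsilon> * (cmod \<eta>)\<^sup>2)"
proof -
  have gap: "z0 + \<eta> *s w - F (\<zeta>0 + \<eta>) = d - R \<eta>" by (simp add: d_def R_def)
  have norm_gap: "(norm (d - R \<eta>))\<^sup>2 = (norm d)\<^sup>2 - 2 * (d \<bullet> R \<eta>) + (norm (R \<eta>))\<^sup>2"
    by (simp add: power2_norm_eq_inner inner_diff inner_commute)
  have norm_parameter: "(cmod (\<zeta>0 + \<eta>))\<^sup>2 = (cmod \<zeta>0)\<^sup>2 + 2 * (\<zeta>0 \<bullet> \<eta>) + (cmod \<eta>)\<^sup>2"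
    by (simp add: power2_norm_eq_inner inner_add inner_commute)
  show ?thesis
    using tangent_le unfolding penalized_def prod.case gap d_def[symmetric] norm_gap norm_parameter
    by (simp add: algebra_simps)
qed

lemma penalized_local_max_tangent_circle:
  fixes F :: "complex \<Rightarrow> complex^'n" and z0 w :: "complex^'n" and \<zeta>0 :: complex
  defines "d \<equiv> z0 - F \<zeta>0" and "R \<equiv> \<lambda>\<eta>. F (\<zeta>0 + \<eta>) - F \<zeta>0 - \<eta> *s w"
  assumes max: "\<forall>\<^sub>F p in nhds (z0, \<zeta>0). penalized f F \<epsilon> N p \<le> penalized f F \<epsilon> N (z0, \<zeta>0)"
    and F: "(F has_derivative (\<lambda>\<eta>. \<eta> *s w)) (at \<zeta>0)" and pos: "\<epsilon> > 0" "N > 0"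
  obtains r \<delta> where "r > 0" "\<delta> > 0"
    "\<And>\<eta>. cmod \<eta> = r \<Longrightarrow> f (z0 + \<eta> *s w) \<le> f z0 - \<delta> - 2 * (\<epsilon> * (\<zeta>0 \<bullet> \<eta>) + N * (d \<bullet> R \<eta>))"
proof -
  define \<kappa> where "\<kappa> = sqrt (\<epsilon> / (2 * N))"
  have \<kappa>: "\<kappa> > 0" "N * \<kappa>\<^sup>2 < \<epsilon>" using pos by (auto simp: \<kappa>_def)
  obtain r1 where r1: "r1 > 0"
    "\<And>\<zeta>. cmod (\<zeta> - \<zeta>0) < r1 \<Longrightarrow> norm (F \<zeta> - F \<zeta>0 - (\<zeta> - \<zeta>0) *s w) \<le> \<kappa> * cmod (\<zeta> - \<zeta>0)"
    using F \<kappa>(1) unfolding has_derivative_at_alt by blast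
  have "((\<lambda>\<eta>. (z0 + \<eta> *s w, \<zeta>0 + \<eta>)) \<longlongrightarrow> (z0 + 0 *s w, \<zeta>0 + 0)) (nhds 0)"
    by (rule continuous_on_tendsto_nhds) (intro continuous_intros)
  then have "\<forall>\<^sub>F \<eta> in nhds 0. penalized f F \<epsilon> N (z0 + \<eta> *s w, \<zeta>0 + \<eta>) \<le> penalized f F \<epsilon> N (z0, \<zeta>0)"
    using eventually_compose_filterlim[OF max] by simp
  then obtain r2 where r2: "r2 > 0"
    "\<And>\<eta>. cmod \<eta> < r2 \<Longrightarrow> penalized f F \<epsilon> N (z0 + \<eta> *s w, \<zeta>0 + \<eta>) \<le> penalized f F \<epsilon> N (z0, \<zeta>0)"
    unfolding eventually_nhds_metric by (auto simp: dist_norm)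
  define r where "r = min r1 r2 / 2"
  have r: "r > 0" "r < r1" "r < r2" using r1(1) r2(1) by (auto simp: r_def)
  show ?thesis
  proof (rule that[of r "(\<epsilon> - N * \<kappa>\<^sup>2) * r\<^sup>2"])
    fix \<eta> assume \<eta>: "cmod \<eta> = r"
    have "norm (R \<eta>) \<le> \<kappa> * r" using r1(2)[of "\<zeta>0 + \<eta>"] \<eta> r(2) by (simp add: R_def)
    then have "(norm (R \<eta>))\<^sup>2 \<le> (\<kappa> * r)\<^sup>2" by (intro power_mono) auto
    then have "N * (norm (R \<eta>))\<^sup>2 \<le> N * \<kappa>\<^sup>2 * r\<^sup>2" using pos(2) by (simp add: power_mult_distrib)
    moreover have "f (z0 + \<eta> *s w) \<le> f z0 - 2 * (\<epsilon> * (\<zeta>0 \<bullet> \<eta>) + N * (d \<bullet> R \<eta>))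
        + (N * (norm (R \<eta>))\<^sup>2 - \<epsilon> * (cmod \<eta>)\<^sup>2)"
      unfolding d_def R_def using \<eta> r(3) by (intro penalized_le_along_tangent r2(2)) simp
    ultimately show "f (z0 + \<eta> *s w) \<le> f z0 - (\<epsilon> - N * \<kappa>\<^sup>2) * r\<^sup>2 - 2 * (\<epsilon> * (\<zeta>0 \<bullet> \<eta>) + N * (d \<bullet> R \<eta>))"
      by (simp add: \<eta> algebra_simps)
  qed (use \<kappa> r(1) in auto)
qed

text \<open>Along the tangent line the first order part of the penalty is the real part of a holomorphic
  function vanishing at \<open>0\<close>, so it does not contribute to the circle average.\<close>

lemma nonneg_psh_penalized_no_local_max:
  fixes f :: "complex^'n \<Rightarrow> real" and F :: "complex \<Rightarrow> complex^'n"
  assumes f: "nonneg_psh f" and F: "\<And>k. (\<lambda>\<zeta>. F \<zeta> $ k) holomorphic_on UNIV"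
    and pos: "\<epsilon> > 0" "N > 0"
  shows "\<not> (\<forall>\<^sub>F p in nhds (z0, \<zeta>0). penalized f F \<epsilon> N p \<le> penalized f F \<epsilon> N (z0, \<zeta>0))"
proof
  assume max: "\<forall>\<^sub>F p in nhds (z0, \<zeta>0). penalized f F \<epsilon> N p \<le> penalized f F \<epsilon> N (z0, \<zeta>0)"
  define w where "w = (\<chi> k. deriv (\<lambda>\<zeta>. F \<zeta> $ k) \<zeta>0)"
  define d where "d = z0 - F \<zeta>0"
  define R where "R = (\<lambda>\<eta>. F (\<zeta>0 + \<eta>) - F \<zeta>0 - \<eta> *s w)"
  have "(F has_derivative (\<lambda>\<eta>. \<eta> *s w)) (at \<zeta>0)"
    by (rule has_derivative_vec_holomorphic) (simp add: w_def holomorphic_derivI[OF F open_UNIV])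
  from penalized_local_max_tangent_circle[OF max this pos]
  obtain r \<delta> where r: "r > 0" "\<delta> > 0"
    "\<And>\<eta>. cmod \<eta> = r \<Longrightarrow> f (z0 + \<eta> *s w) \<le> f z0 - \<delta> - 2 * (\<epsilon> * (\<zeta>0 \<bullet> \<eta>) + N * (d \<bullet> R \<eta>))"
    unfolding d_def R_def by blast
  define Q where
    "Q = (\<lambda>\<eta>. of_real (f z0 - \<delta>)
      - 2 * (of_real \<epsilon> * (cnj \<zeta>0 * \<eta>) + of_real N * (\<Sum>k\<in>UNIV. cnj (d $ k) * R \<eta> $ k)))"
  have Re_Q: "Re (Q \<eta>) = f z0 - \<delta> - 2 * (\<epsilon> * (\<zeta>0 \<bullet> \<eta>) + N * (d \<bullet> R \<eta>))" for \<eta>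
    by (simp add: Q_def inner_vec_def inner_complex_def)
  have "f z0 \<le> Re (Q (of_real r * 0))"
  proof (rule nonneg_psh_le_Re_holomorphic[OF f])
    show "(\<lambda>\<zeta>. Q (of_real r * \<zeta>)) holomorphic_on cball 0 1"
      unfolding Q_def R_def
      by (auto intro!: holomorphic_intros holomorphic_on_compose_gen[OF _ F, unfolded o_def])
    show "f (z0 + cis \<theta> *s (of_real r *s w)) \<le> Re (Q (of_real r * cis \<theta>))" for \<theta>
      using r(3)[of "of_real r * cis \<theta>"] r(1)
      by (simp add: Re_Q norm_mult vector_smult_assoc mult.commute)
  qed
  then show False using r(2) by (simp add: Re_Q R_def)
qed

lemma nonneg_psh_maximum_principle_entire_curve:
  fixes f :: "complex^'n \<Rightarrow> real" and F :: "complex \<Rightarrow> complex^'n"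
  assumes f: "nonneg_psh f" and F: "\<And>k. (\<lambda>\<zeta>. F \<zeta> $ k) holomorphic_on UNIV"
    and bound: "\<And>\<zeta>. cmod \<zeta> = 1 \<Longrightarrow> f (F \<zeta>) \<le> c"
  shows "f (F 0) \<le> c"
proof (rule ccontr)
  assume "\<not> ?thesis"
  then have greater: "c < f (F 0)" by simp
  have "continuous_on UNIV (\<lambda>\<zeta>. \<chi> k. F \<zeta> $ k)"
    by (intro continuous_on_vec_lambda holomorphic_on_imp_continuous_on F)
  then have "continuous_on UNIV F" by simp
  from penalized_local_max[OF nonneg_psh_usc[OF f] this bound greater] show False
    using nonneg_psh_penalized_no_local_max[OF f F] by metis
qed

section \<open>Approximation on the unit circle\<close>

definition Re_poly_on_circle :: "(complex \<Rightarrow> real) \<Rightarrow> bool" where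
  "Re_poly_on_circle g \<longleftrightarrow> (\<exists>p::complex poly. \<forall>\<zeta>. cmod \<zeta> = 1 \<longrightarrow> g \<zeta> = Re (poly p \<zeta>))"

lemma Re_poly_on_circleI: "(\<And>\<zeta>. cmod \<zeta> = 1 \<Longrightarrow> g \<zeta> = Re (poly p \<zeta>)) \<Longrightarrow> Re_poly_on_circle g"
  unfolding Re_poly_on_circle_def by blast

lemma Re_poly_on_circle_add:
  "Re_poly_on_circle f \<Longrightarrow> Re_poly_on_circle g \<Longrightarrow> Re_poly_on_circle (\<lambda>\<zeta>. f \<zeta> + g \<zeta>)"
  unfolding Re_poly_on_circle_def by (metis poly_add plus_complex.sel(1))

lemma Re_poly_on_circle_sum:
  "(\<And>i. i \<in> I \<Longrightarrow> Re_poly_on_circle (f i)) \<Longrightarrow> Re_poly_on_circle (\<lambda>\<zeta>. \<Sum>i\<in>I. f i \<zeta>)"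
proof (induction I rule: infinite_finite_induct)
  case (insert x F)
  then show ?case by (simp add: Re_poly_on_circle_add)
qed (auto intro!: Re_poly_on_circleI[of _ 0])

lemma Re_poly_on_circle_monom_mult:
  "Re_poly_on_circle (\<lambda>\<zeta>. Re (c * \<zeta> ^ n) * Re (d * \<zeta> ^ m))"
proof (induction n m arbitrary: c d rule: linorder_wlog)
  case (le m n)
  show ?case
  proof (rule Re_poly_on_circleI)
    fix \<zeta> :: complex assume "cmod \<zeta> = 1"
    then have unit: "\<zeta> ^ m * cnj \<zeta> ^ m = 1"
      using complex_norm_square[of \<zeta>] by (simp add: power_mult_distrib[symmetric])
    have "\<zeta> ^ n = \<zeta> ^ (n - m) * \<zeta> ^ m" using le by (simp flip: power_add)
    then have "cnj (c * \<zeta> ^ m) * (d * \<zeta> ^ n) = cnj c * d * \<zeta> ^ (n - m) * (\<zeta> ^ m * cnj \<zeta> ^ m)"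
      by simp
    then have conj: "cnj (c * \<zeta> ^ m) * (d * \<zeta> ^ n) = cnj c * d * \<zeta> ^ (n - m)"
      by (simp only: unit mult_1_right)
    have "Re x * Re y = Re (x * y / 2 + cnj x * y / 2)" for x y
      by (simp add: field_simps)
    then have "Re (c * \<zeta> ^ m) * Re (d * \<zeta> ^ n)
        = Re ((c * \<zeta> ^ m) * (d * \<zeta> ^ n) / 2 + cnj (c * \<zeta> ^ m) * (d * \<zeta> ^ n) / 2)" .
    also have "(c * \<zeta> ^ m) * (d * \<zeta> ^ n) / 2 + cnj (c * \<zeta> ^ m) * (d * \<zeta> ^ n) / 2
        = poly (monom (c * d / 2) (m + n) + monom (cnj c * d / 2) (n - m)) \<zeta>"
      unfolding conj by (simp add: poly_monom power_add mult_ac)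
    finally show "Re (c * \<zeta> ^ m) * Re (d * \<zeta> ^ n)
        = Re (poly (monom (c * d / 2) (m + n) + monom (cnj c * d / 2) (n - m)) \<zeta>)" .
  qed
next
  case (sym m n)
  from sym[of d c] show ?case by (simp add: mult.commute)
qed

lemma Re_poly_on_circle_mult:
  assumes "Re_poly_on_circle f" "Re_poly_on_circle g"
  shows "Re_poly_on_circle (\<lambda>\<zeta>. f \<zeta> * g \<zeta>)"
proof -
  obtain p q where p: "\<And>\<zeta>. cmod \<zeta> = 1 \<Longrightarrow> f \<zeta> = Re (poly p \<zeta>)"
    and q: "\<And>\<zeta>. cmod \<zeta> = 1 \<Longrightarrow> g \<zeta> = Re (poly q \<zeta>)"
    using assms unfolding Re_poly_on_circle_def by metis
  have "Re_poly_on_circle (\<lambda>\<zeta>. \<Sum>i\<le>degree p. \<Sum>j\<le>degree q. Re (coeff p i * \<zeta>^i) * Re (coeff q j * \<zeta>^j))"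
    by (intro Re_poly_on_circle_sum Re_poly_on_circle_monom_mult)
  moreover have "f \<zeta> * g \<zeta> = (\<Sum>i\<le>degree p. \<Sum>j\<le>degree q. Re (coeff p i * \<zeta>^i) * Re (coeff q j * \<zeta>^j))"
    if "cmod \<zeta> = 1" for \<zeta>
    unfolding p[OF that] q[OF that] poly_altdef Re_sum sum_product ..
  ultimately show ?thesis unfolding Re_poly_on_circle_def by (elim exE, intro exI) auto
qed

lemma Re_poly_on_circle_real_polynomial_function:
  "real_polynomial_function g \<Longrightarrow> Re_poly_on_circle g"
proof (induction rule: real_polynomial_function.induct)
  case (linear f)
  show ?case
  proof (rule Re_poly_on_circleI)
    fix \<zeta>
    have "f (Re \<zeta> *\<^sub>R 1 + Im \<zeta> *\<^sub>R \<i>) = Re \<zeta> * f 1 + Im \<zeta> * f \<i>"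
      using bounded_linear.linear[OF linear] by (simp only: linear_add linear_scale real_scaleR_def)
    moreover have "Re \<zeta> *\<^sub>R 1 + Im \<zeta> *\<^sub>R \<i> = \<zeta>" by (simp add: complex_eq_iff)
    ultimately show "f \<zeta> = Re (poly [:0, of_real (f 1) - \<i> * of_real (f \<i>):] \<zeta>)"
      by (simp add: algebra_simps)
  qed
next
  case (const c)
  show ?case by (rule Re_poly_on_circleI[of _ "[:of_real c:]"]) simp
qed (auto intro: Re_poly_on_circle_add Re_poly_on_circle_mult)

lemma Re_poly_approximation_on_circle:
  fixes \<phi> :: "complex \<Rightarrow> real"
  assumes "continuous_on (sphere 0 1) \<phi>" "0 < e"
  obtains p where "\<And>\<zeta>. cmod \<zeta> = 1 \<Longrightarrow> \<bar>\<phi> \<zeta> - Re (poly p \<zeta>)\<bar> < e"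
proof -
  obtain g where g: "real_polynomial_function g" "\<And>x. x \<in> sphere 0 1 \<Longrightarrow> \<bar>\<phi> x - g x\<bar> < e"
    using Stone_Weierstrass_real_polynomial_function[OF compact_sphere assms] by blast
  obtain p where "\<And>\<zeta>. cmod \<zeta> = 1 \<Longrightarrow> g \<zeta> = Re (poly p \<zeta>)"
    using Re_poly_on_circle_real_polynomial_function[OF g(1)] unfolding Re_poly_on_circle_def by blast
  with g(2) show ?thesis by (intro that[of p]) force
qed

definition sup_convolution :: "'a::metric_space set \<Rightarrow> ('a \<Rightarrow> real) \<Rightarrow> real \<Rightarrow> 'a \<Rightarrow> real" where
  "sup_convolution S g L x = (SUP w\<in>S. g w - L * dist x w)"

context
  fixes S :: "'a::metric_space set" and g :: "'a \<Rightarrow> real" and M :: real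
  assumes S_nonempty: "S \<noteq> {}" and bound: "\<And>w. w \<in> S \<Longrightarrow> g w \<le> M"
begin

lemma sup_convolution_term_le: "0 \<le> L \<Longrightarrow> w \<in> S \<Longrightarrow> g w - L * dist x w \<le> M"
  by (rule order_trans[of _ "g w"]) (auto intro: bound)

lemma bdd_above_sup_convolution: "0 \<le> L \<Longrightarrow> bdd_above ((\<lambda>w. g w - L * dist x w) ` S)"
  by (rule bdd_aboveI2[of _ _ M]) (rule sup_convolution_term_le)

lemma sup_convolution_le: "0 \<le> L \<Longrightarrow> sup_convolution S g L x \<le> M"
  unfolding sup_convolution_def by (intro cSUP_least S_nonempty sup_convolution_term_le)

lemma le_sup_convolution: "0 \<le> L \<Longrightarrow> x \<in> S \<Longrightarrow> g x \<le> sup_convolution S g L x"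
  unfolding sup_convolution_def using cSUP_upper[OF _ bdd_above_sup_convolution, of x L x] by simp

lemma lipschitz_sup_convolution:
  assumes L: "0 \<le> L"
  shows "L-lipschitz_on UNIV (sup_convolution S g L)"
proof (rule lipschitz_onI[OF _ L])
  have one_sided: "sup_convolution S g L x \<le> sup_convolution S g L y + L * dist x y" for x y
    unfolding sup_convolution_def
  proof (rule cSUP_least[OF S_nonempty])
    fix w assume w: "w \<in> S"
    have "L * dist y w \<le> L * (dist x y + dist x w)"
      using L by (intro mult_left_mono) (auto simp: dist_triangle3)
    moreover have "g w - L * dist y w \<le> (SUP w\<in>S. g w - L * dist y w)"
      by (rule cSUP_upper[OF w bdd_above_sup_convolution[OF L]])
    ultimately show "g w - L * dist x w \<le> (SUP w\<in>S. g w - L * dist y w) + L * dist x y"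
      by (simp add: algebra_simps)
  qed
  show "dist (sup_convolution S g L x) (sup_convolution S g L y) \<le> L * dist x y" for x y
    using one_sided[of x y] one_sided[of y x] by (simp add: dist_real_def abs_le_iff dist_commute)
qed

lemma sup_convolution_tendsto:
  assumes g: "usc g" and x: "x \<in> S"
  shows "(\<lambda>n. sup_convolution S g (real n) x) \<longlonglongrightarrow> g x"
proof (rule order_tendstoI)
  show "\<forall>\<^sub>F n in sequentially. c < sup_convolution S g (real n) x" if "c < g x" for c
    using less_le_trans[OF that le_sup_convolution[OF _ x]] by simp
next
  fix c assume "g x < c"
  then obtain c' where c': "g x < c'" "c' < c" using dense by blast
  obtain \<delta> where \<delta>: "\<delta> > 0" "\<And>w. dist w x < \<delta> \<Longrightarrow> g w < c'"
    using uscD[OF g c'(1)] by (auto simp: eventually_nhds_metric)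
  have "\<forall>\<^sub>F n in sequentially. M - c' < real n * \<delta>"
    using \<delta>(1) by real_asymp
  then show "\<forall>\<^sub>F n in sequentially. sup_convolution S g (real n) x < c"
  proof eventually_elim
    case (elim n)
    have "sup_convolution S g (real n) x \<le> c'"
      unfolding sup_convolution_def
    proof (rule cSUP_least[OF S_nonempty])
      fix w assume w: "w \<in> S"
      show "g w - real n * dist x w \<le> c'"
      proof (cases "dist w x < \<delta>")
        case True
        moreover have "0 \<le> real n * dist x w" by simp
        ultimately show ?thesis using \<delta>(2)[of w] by linarith
      next
        case False
        then have "real n * \<delta> \<le> real n * dist x w"
          by (intro mult_left_mono) (auto simp: dist_commute)
        then show ?thesis using bound[OF w] elim by linarith
      qed
    qed
    with c'(2) show ?case by linarith
  qed
qed

end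

lemma usc_continuous_majorants:
  fixes g :: "'a::metric_space \<Rightarrow> real"
  assumes g: "usc g" and S: "compact S" "S \<noteq> {}" and less: "\<And>x. x \<in> S \<Longrightarrow> g x < c"
  obtains \<phi> :: "nat \<Rightarrow> 'a \<Rightarrow> real" where "\<And>n. continuous_on UNIV (\<phi> n)"
    "\<And>n x. x \<in> S \<Longrightarrow> g x < \<phi> n x" "\<And>n x. \<phi> n x \<le> c"
    "\<And>x. x \<in> S \<Longrightarrow> (\<lambda>n. \<phi> n x) \<longlonglongrightarrow> g x"
proof -
  obtain x0 where x0: "x0 \<in> S" "\<And>x. x \<in> S \<Longrightarrow> g x \<le> g x0"
    using usc_attains_sup[OF g S] by auto
  define e where "e = (\<lambda>n. (c - g x0) / real (Suc n))"
  have e: "0 < e n" "e n \<le> c - g x0" for n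
    using less[OF x0(1)] divide_left_mono[of 1 "real (Suc n)" "c - g x0"] by (auto simp: e_def)
  let ?g = "\<lambda>n. sup_convolution S g (real n)"
  have lipschitz: "(real n)-lipschitz_on UNIV (?g n)" for n
    by (rule lipschitz_sup_convolution[OF S(2) x0(2)]) auto
  have lower: "g x \<le> ?g n x" if "x \<in> S" for n x
    by (rule le_sup_convolution[OF S(2) x0(2)]) (use that in auto)
  have upper: "?g n x \<le> g x0" for n x
    by (rule sup_convolution_le[OF S(2) x0(2)]) auto
  have lim: "(\<lambda>n. ?g n x) \<longlonglongrightarrow> g x" if "x \<in> S" for x
    by (rule sup_convolution_tendsto[OF S(2) x0(2) g that])
  show ?thesis
  proof
    show "continuous_on UNIV (\<lambda>x. ?g n x + e n)" for n
      using lipschitz_on_continuous_on[OF lipschitz] by (intro continuous_on_add continuous_on_const)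
    show "g x < ?g n x + e n" if "x \<in> S" for n x
      using lower[OF that, of n] e(1)[of n] by simp
    show "?g n x + e n \<le> c" for n x
      using upper[of n x] e(2)[of n] by simp
    have "e \<longlonglongrightarrow> 0" unfolding e_def by real_asymp
    then show "(\<lambda>n. ?g n x + e n) \<longlonglongrightarrow> g x" if "x \<in> S" for x
      using tendsto_add[OF lim[OF that]] by fastforce
  qed
qed

section \<open>Logarithmic plurisubharmonicity of homogeneous functions\<close>

definition homogeneous :: "real^'n \<Rightarrow> (complex^'n \<Rightarrow> real) \<Rightarrow> bool" where
  "homogeneous lam f \<longleftrightarrow> (\<forall>z t. f (Phi lam z t) = exp (- Re t) * f z)"

definition homogeneous_psh :: "real^'n \<Rightarrow> (complex^'n \<Rightarrow> real) \<Rightarrow> bool" where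
  "homogeneous_psh lam f \<longleftrightarrow> nonneg_psh f \<and> homogeneous lam f"

lemma homogeneousD: "homogeneous lam f \<Longrightarrow> f (Phi lam z t) = exp (- Re t) * f z"
  by (simp add: homogeneous_def)

lemma homogeneous_pshD:
  assumes "homogeneous_psh lam f"
  shows homogeneous_psh_nonneg_psh: "nonneg_psh f"
    and homogeneous_psh_homogeneous: "homogeneous lam f"
    and homogeneous_psh_nonneg: "0 \<le> f z"
    and homogeneous_psh_usc: "usc f"
  using assms by (auto simp: homogeneous_psh_def nonneg_pshD)

lemma Phi_zero [simp]: "Phi lam 0 t = 0"
  by (simp add: Phi_def vec_eq_iff)

lemma Phi_inverse [simp]: "Phi lam (Phi lam z t) (- t) = z" "Phi lam (Phi lam z (- t)) t = z"
  by (simp_all add: Phi_def vec_eq_iff exp_minus)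

lemma continuous_on_Phi: "continuous_on UNIV (\<lambda>z. Phi lam z t)"
  unfolding Phi_def by (intro continuous_on_vec_lambda continuous_intros)

lemma homogeneous_zero: "homogeneous lam f \<Longrightarrow> f 0 = 0"
  using homogeneousD[of lam f 0 1] by simp

lemma H_lam_iff: "v \<in> H_lam lam \<longleftrightarrow> (\<exists>f. homogeneous_psh lam f \<and> (\<exists>z. f z \<noteq> 0) \<and> v = (\<lambda>z. ereal (f z)))"
proof
  assume v: "v \<in> H_lam lam"
  define f where "f = (\<lambda>z. real_of_ereal (v z))"
  have "v z = ereal (f z)" for z
  proof -
    have "0 \<le> v z" "v z < \<infinity>" using v by (auto simp: H_lam_def psh_def)
    then show ?thesis unfolding f_def by (cases "v z") auto
  qed
  then have v_eq: "v = (\<lambda>z. ereal (f z))" by auto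
  note f = v[unfolded H_lam_def v_eq mem_Collect_eq]
  then have "0 \<le> f z" for z by auto
  then have "homogeneous_psh lam f"
    using f by (simp add: homogeneous_psh_def homogeneous_def psh_ereal_iff)
  moreover have "\<exists>z. f z \<noteq> 0" using f by auto metis
  ultimately show "\<exists>f. homogeneous_psh lam f \<and> (\<exists>z. f z \<noteq> 0) \<and> v = (\<lambda>z. ereal (f z))"
    using v_eq by blast
next
  assume "\<exists>f. homogeneous_psh lam f \<and> (\<exists>z. f z \<noteq> 0) \<and> v = (\<lambda>z. ereal (f z))"
  then obtain f z where f: "homogeneous_psh lam f" "f z \<noteq> 0" and v: "v = (\<lambda>z. ereal (f z))" by blast
  have "v z \<noteq> v 0"
    using f(2) homogeneous_zero[OF homogeneous_psh_homogeneous[OF f(1)]] by (simp add: v)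
  then show "v \<in> H_lam lam"
    using f(1) homogeneous_pshD[OF f(1)]
    by (auto simp: H_lam_def v psh_ereal_iff homogeneousD)
qed

lemma homogeneous_psh_cmult:
  assumes "homogeneous_psh lam f" "0 \<le> c"
  shows "homogeneous_psh lam (\<lambda>z. c * f z)"
  using assms nonneg_psh_cmult[of f c] homogeneousD[of lam f]
  by (auto simp: homogeneous_psh_def homogeneous_def)

lemma homogeneous_psh_exp_majorant:
  assumes f: "homogeneous_psh lam f" and P: "P holomorphic_on UNIV"
    and majorant: "\<And>\<zeta>. cmod \<zeta> = 1 \<Longrightarrow> f (a + \<zeta> *s b) \<le> exp (Re (P \<zeta>))"
  shows "f a \<le> exp (Re (P 0))"
proof -
  let ?F = "\<lambda>\<zeta>. Phi lam (a + \<zeta> *s b) (P \<zeta>)"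
  note flow = homogeneousD[OF homogeneous_psh_homogeneous[OF f]]
  have "f (?F 0) \<le> 1"
  proof (rule nonneg_psh_maximum_principle_entire_curve[OF homogeneous_psh_nonneg_psh[OF f]])
    show "(\<lambda>\<zeta>. ?F \<zeta> $ k) holomorphic_on UNIV" for k
      unfolding Phi_def by (auto intro!: holomorphic_intros P)
    show "f (?F \<zeta>) \<le> 1" if "cmod \<zeta> = 1" for \<zeta>
      using majorant[OF that] by (simp add: flow exp_minus field_simps)
  qed
  then show ?thesis by (simp add: flow exp_minus field_simps)
qed

lemma homogeneous_psh_ln_le_mean:
  assumes f: "homogeneous_psh lam f" and \<phi>: "continuous_on (sphere 0 1) \<phi>"
    and majorant: "\<And>\<zeta>. cmod \<zeta> = 1 \<Longrightarrow> f (a + \<zeta> *s b) \<le> exp (\<phi> \<zeta>)" and pos: "0 < f a"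
  shows "ln (f a) \<le> (\<integral>\<theta>. \<phi> (cis \<theta>) \<partial>uniform_angle)"
proof (rule field_le_epsilon)
  have \<phi>_integrable: "integrable uniform_angle (\<lambda>\<theta>. \<phi> (cis \<theta>))"
    using circle_integrable[OF \<phi>] by simp
  fix e :: real assume "0 < e"
  then have e: "0 < e / 2" by simp
  obtain p where p: "\<And>\<zeta>. cmod \<zeta> = 1 \<Longrightarrow> \<bar>\<phi> \<zeta> - Re (poly p \<zeta>)\<bar> < e / 2"
    using Re_poly_approximation_on_circle[OF \<phi> e] by blast
  have bounds: "\<phi> \<zeta> \<le> Re (poly p \<zeta>) + e / 2" "Re (poly p \<zeta>) \<le> \<phi> \<zeta> + e / 2" if "cmod \<zeta> = 1" for \<zeta>
    using p[OF that] by linarith+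
  have "poly p holomorphic_on cball 0 1" by (intro holomorphic_intros)
  note mean = holomorphic_mean_value[OF this, simplified]
  have "f a \<le> exp (Re (poly p 0 + of_real (e / 2)))"
  proof (rule homogeneous_psh_exp_majorant[OF f])
    show "f (a + \<zeta> *s b) \<le> exp (Re (poly p \<zeta> + of_real (e / 2)))" if "cmod \<zeta> = 1" for \<zeta>
      using majorant[OF that] bounds(1)[OF that] order_trans by fastforce
  qed (intro holomorphic_intros)
  then have "exp (ln (f a)) \<le> exp (Re (poly p 0) + e / 2)" using pos by simp
  then have "ln (f a) \<le> Re (poly p 0) + e / 2" by simp
  also have "Re (poly p 0) = (\<integral>\<theta>. Re (poly p (cis \<theta>)) \<partial>uniform_angle)"
    using integral_Re[OF mean(1)] by (simp add: mean)
  also have "\<dots> \<le> (\<integral>\<theta>. \<phi> (cis \<theta>) + e / 2 \<partial>uniform_angle)"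
  proof (rule integral_mono)
    show "integrable uniform_angle (\<lambda>\<theta>. \<phi> (cis \<theta>) + e / 2)"
      using \<phi>_integrable by simp
    show "Re (poly p (cis \<theta>)) \<le> \<phi> (cis \<theta>) + e / 2" for \<theta>
      by (rule bounds(2)) simp
  qed (intro integrable_Re mean)
  also have "\<dots> = (\<integral>\<theta>. \<phi> (cis \<theta>) \<partial>uniform_angle) + e / 2"
    using \<phi>_integrable by (simp add: uniform_angle.prob_space[simplified])
  finally show "ln (f a) \<le> (\<integral>\<theta>. \<phi> (cis \<theta>) \<partial>uniform_angle) + e" by simp
qed

definition neglog :: "real \<Rightarrow> ennreal" where
  "neglog x = (if x \<le> 0 then \<infinity> else ennreal (- ln x))"

lemma neglog_pos: "0 < x \<Longrightarrow> neglog x = ennreal (- ln x)"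
  and neglog_nonpos: "x \<le> 0 \<Longrightarrow> neglog x = \<infinity>"
  by (simp_all add: neglog_def)

lemma neglog_eq_top_iff: "neglog x = top \<longleftrightarrow> x \<le> 0"
  by (simp add: neglog_def)

lemma neglog_antimono: "x \<le> y \<Longrightarrow> neglog y \<le> neglog x"
  by (auto simp: neglog_def intro!: ennreal_leI)

lemma neglog_mult:
  assumes "0 \<le> x" "x \<le> 1" "0 \<le> y" "y \<le> 1"
  shows "neglog (x * y) = neglog x + neglog y"
proof (cases "x = 0 \<or> y = 0")
  case False
  then have "0 < x" "0 < y" using assms by auto
  then show ?thesis
    using assms by (simp add: neglog_pos ln_mult flip: ennreal_plus)
qed (auto simp: neglog_def)

lemma neglog_powr:
  assumes "0 \<le> x" "0 < \<alpha>"
  shows "neglog (x powr \<alpha>) = ennreal \<alpha> * neglog x"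
proof (cases "x = 0")
  case True
  then show ?thesis using assms(2) by (simp add: neglog_def ennreal_mult_top)
next
  case False
  then show ?thesis
    using assms by (simp add: neglog_pos ln_powr ennreal_mult'[symmetric])
qed

lemma isCont_neglog: "isCont neglog y"
proof (cases y "0::real" rule: linorder_cases)
  case less
  then have "\<forall>\<^sub>F x in nhds y. neglog x = \<infinity>"
    using eventually_nhds_in_open[of "{..<0}" y] by (auto elim!: eventually_mono simp: neglog_nonpos)
  then show ?thesis by (rule isCont_cong[THEN iffD2]) simp
next
  case greater
  then have "\<forall>\<^sub>F x in nhds y. neglog x = ennreal (- ln x)"
    using eventually_nhds_in_open[of "{0<..}" y] by (auto elim!: eventually_mono simp: neglog_pos)
  then show ?thesis
    by (rule isCont_cong[THEN iffD2]) (use greater in \<open>auto simp: isCont_def intro!: tendsto_intros\<close>)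
next
  case equal
  have "(neglog \<longlongrightarrow> \<infinity>) (at_left 0)"
    by (rule tendsto_eventually) (auto simp: eventually_at_filter neglog_nonpos)
  moreover have "((\<lambda>x. ennreal (- ln x)) \<longlongrightarrow> \<infinity>) (at_right 0)"
    using ln_at_0 by (simp add: ennreal_tendsto_top_eq_at_top filterlim_uminus_at_top)
  then have "(neglog \<longlongrightarrow> \<infinity>) (at_right 0)"
    by (rule tendsto_cong[THEN iffD1, rotated]) (auto simp: eventually_at_filter neglog_pos)
  ultimately show ?thesis
    by (simp add: equal isCont_def filterlim_at_split neglog_nonpos)
qed

lemma neglog_measurable [measurable]: "neglog \<in> borel_measurable borel"
  by (intro borel_measurable_continuous_onI continuous_at_imp_continuous_on ballI isCont_neglog)

lemma homogeneous_psh_neglog_mean_le_of_majorant: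
  assumes f: "homogeneous_psh lam f" and x: "continuous_on (sphere 0 1) x"
    "\<And>\<zeta>. cmod \<zeta> = 1 \<Longrightarrow> 0 < x \<zeta>" "\<And>\<zeta>. cmod \<zeta> = 1 \<Longrightarrow> x \<zeta> \<le> 1"
    and majorant: "\<And>\<zeta>. cmod \<zeta> = 1 \<Longrightarrow> f (a + \<zeta> *s b) \<le> x \<zeta>"
  shows "(\<integral>\<^sup>+\<theta>. neglog (x (cis \<theta>)) \<partial>uniform_angle) \<le> neglog (f a)"
proof (cases "0 < f a")
  case True
  have ln_x: "continuous_on (sphere 0 1) (\<lambda>\<zeta>. ln (x \<zeta>))"
    using x(1,2) by (intro continuous_on_ln) force+
  have int: "integrable uniform_angle (\<lambda>\<theta>. ln (x (cis \<theta>)))"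
    using circle_integrable[OF ln_x] by simp
  have "(\<integral>\<^sup>+\<theta>. neglog (x (cis \<theta>)) \<partial>uniform_angle) = (\<integral>\<^sup>+\<theta>. ennreal (- ln (x (cis \<theta>))) \<partial>uniform_angle)"
    using x(2) by (simp add: neglog_pos)
  also have "\<dots> = ennreal (- (\<integral>\<theta>. ln (x (cis \<theta>)) \<partial>uniform_angle))"
    using int x(2,3) by (subst nn_integral_eq_integral) (auto simp: ln_le_zero_iff)
  also have "\<dots> \<le> ennreal (- ln (f a))"
    using homogeneous_psh_ln_le_mean[OF f ln_x _ True, of b] majorant x(2) by (intro ennreal_leI) simp
  finally show ?thesis using True by (simp add: neglog_pos)
qed (simp add: neglog_nonpos)

lemma homogeneous_psh_neglog_supermean:
  assumes f: "homogeneous_psh lam f" and less_1: "\<And>\<theta>. f (a + cis \<theta> *s b) < 1"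
  shows "(\<integral>\<^sup>+\<theta>. neglog (f (a + cis \<theta> *s b)) \<partial>uniform_angle) \<le> neglog (f a)"
proof -
  have line: "usc (\<lambda>\<zeta>. f (a + \<zeta> *s b))"
    by (rule usc_compose[OF homogeneous_psh_usc[OF f]]) (intro continuous_intros)
  have circle: "f (a + \<zeta> *s b) < 1" if "\<zeta> \<in> sphere 0 1" for \<zeta>
    using less_1[of "Arg \<zeta>"] rcis_cmod_Arg[of \<zeta>] that by (simp add: rcis_def)
  have "sphere (0::complex) 1 \<noteq> {}" by (auto intro!: exI[of _ 1])
  from usc_continuous_majorants[OF line compact_sphere this circle]
  obtain \<phi> :: "nat \<Rightarrow> complex \<Rightarrow> real" where \<phi>: "\<And>n. continuous_on UNIV (\<phi> n)"
    "\<And>n \<zeta>. \<zeta> \<in> sphere 0 1 \<Longrightarrow> f (a + \<zeta> *s b) < \<phi> n \<zeta>" "\<And>n \<zeta>. \<phi> n \<zeta> \<le> 1"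
    "\<And>\<zeta>. \<zeta> \<in> sphere 0 1 \<Longrightarrow> (\<lambda>n. \<phi> n \<zeta>) \<longlonglongrightarrow> f (a + \<zeta> *s b)" by metis
  have majorant: "(\<integral>\<^sup>+\<theta>. neglog (\<phi> n (cis \<theta>)) \<partial>uniform_angle) \<le> neglog (f a)" for n
  proof (rule homogeneous_psh_neglog_mean_le_of_majorant[OF f])
    show "continuous_on (sphere 0 1) (\<phi> n)" using \<phi>(1) continuous_on_subset by blast
    fix \<zeta> assume "cmod \<zeta> = 1"
    then show "f (a + \<zeta> *s b) \<le> \<phi> n \<zeta>" "0 < \<phi> n \<zeta>"
      using \<phi>(2)[of \<zeta> n] homogeneous_psh_nonneg[OF f, of "a + \<zeta> *s b"] by auto
  qed (rule \<phi>(3))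
  have "(\<lambda>n. neglog (\<phi> n (cis \<theta>))) \<longlonglongrightarrow> neglog (f (a + cis \<theta> *s b))" for \<theta>
    by (rule isCont_tendsto_compose[OF isCont_neglog \<phi>(4)]) simp
  then have "(\<integral>\<^sup>+\<theta>. neglog (f (a + cis \<theta> *s b)) \<partial>uniform_angle)
      = (\<integral>\<^sup>+\<theta>. liminf (\<lambda>n. neglog (\<phi> n (cis \<theta>))) \<partial>uniform_angle)"
    by (intro nn_integral_cong lim_imp_Liminf[symmetric]) simp
  also have "\<dots> \<le> liminf (\<lambda>n. \<integral>\<^sup>+\<theta>. neglog (\<phi> n (cis \<theta>)) \<partial>uniform_angle)"
  proof (rule nn_integral_liminf)
    have "(\<lambda>\<theta>. \<phi> n (cis \<theta>)) \<in> borel_measurable borel" for n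
      by (intro borel_measurable_continuous_onI continuous_on_compose2[OF \<phi>(1)] continuous_intros) auto
    then show "(\<lambda>\<theta>. neglog (\<phi> n (cis \<theta>))) \<in> borel_measurable uniform_angle" for n
      by measurable
  qed
  also have "\<dots> \<le> neglog (f a)"
    using majorant by (intro Liminf_le always_eventually allI) auto
  finally show ?thesis .
qed

section \<open>Averages over balls\<close>

lemma nn_integral_translate:
  fixes M :: "'a::{real_normed_vector,second_countable_topology} measure"
  assumes "distr M borel ((+) a) = M" "sets M = sets borel" "g \<in> borel_measurable borel"
  shows "(\<integral>\<^sup>+x. g (a + x) \<partial>M) = (\<integral>\<^sup>+x. g x \<partial>M)"
proof -
  have "(+) a \<in> M \<rightarrow>\<^sub>M borel"
    by (subst measurable_cong_sets[OF assms(2) refl]) measurable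
  then have "(\<integral>\<^sup>+x. g x \<partial>distr M borel ((+) a)) = (\<integral>\<^sup>+x. g (a + x) \<partial>M)"
    using assms(3) by (intro nn_integral_distr) auto
  then show ?thesis by (simp add: assms(1))
qed

text \<open>Fubini for the indicator of \<open>{(y, x). y \<in> B \<and> x + y \<in> A}\<close>.\<close>

lemma translation_invariant_measures_proportional:
  fixes M N :: "'a::{real_normed_vector,second_countable_topology} measure"
  assumes "sigma_finite_measure M" "sigma_finite_measure N"
    and sets_M: "sets M = sets borel" and sets_N: "sets N = sets borel"
    and translate: "\<And>a. distr M borel ((+) a) = M" "\<And>a. distr N borel ((+) a) = N"
    and A: "A \<in> sets borel" and B: "B \<in> sets borel"
  shows "emeasure M A * emeasure N B = emeasure N A * emeasure M (uminus -` B)"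
proof -
  interpret M: sigma_finite_measure M by fact
  interpret N: sigma_finite_measure N by fact
  interpret pair_sigma_finite N M ..
  note [measurable_cong] = sets_M sets_N and [measurable] = A B
  have [measurable]: "uminus -` B \<in> sets borel"
    using measurable_sets[of uminus borel borel B] by simp
  let ?ind = "indicator :: 'a set \<Rightarrow> 'a \<Rightarrow> ennreal"
  have "emeasure M A * emeasure N B = (\<integral>\<^sup>+y. (\<integral>\<^sup>+x. ?ind A x \<partial>M) * ?ind B y \<partial>N)"
    by (subst nn_integral_cmult) (auto simp: sets_M sets_N)
  also have "\<dots> = (\<integral>\<^sup>+y. (\<integral>\<^sup>+x. ?ind A (y + x) * ?ind B y \<partial>M) \<partial>N)"
    by (subst nn_integral_multc) (auto simp: nn_integral_translate[OF translate(1) sets_M])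
  also have "\<dots> = (\<integral>\<^sup>+x. (\<integral>\<^sup>+y. ?ind A (y + x) * ?ind B y \<partial>N) \<partial>M)"
    by (rule Fubini'[symmetric]) measurable
  also have "\<dots> = (\<integral>\<^sup>+x. (\<integral>\<^sup>+y. ?ind A (- x + y + x) * ?ind B (- x + y) \<partial>N) \<partial>M)"
    by (intro nn_integral_cong nn_integral_translate[OF translate(2) sets_N, symmetric]) measurable
  also have "\<dots> = (\<integral>\<^sup>+y. (\<integral>\<^sup>+x. ?ind A (- x + y + x) * ?ind B (- x + y) \<partial>M) \<partial>N)"
    by (rule Fubini') measurable
  also have "\<dots> = (\<integral>\<^sup>+y. (\<integral>\<^sup>+x. ?ind A y * ?ind (uminus -` B) (- y + x) \<partial>M) \<partial>N)"
    by (intro nn_integral_cong) (auto simp: indicator_def)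
  also have "\<dots> = (\<integral>\<^sup>+y. ?ind A y * emeasure M (uminus -` B) \<partial>N)"
  proof (intro nn_integral_cong)
    fix y
    have "(\<integral>\<^sup>+x. ?ind (uminus -` B) (- y + x) \<partial>M) = emeasure M (uminus -` B)"
      by (subst nn_integral_translate[OF translate(1) sets_M]) (auto simp: sets_M)
    then show "(\<integral>\<^sup>+x. ?ind A y * ?ind (uminus -` B) (- y + x) \<partial>M) = ?ind A y * emeasure M (uminus -` B)"
      by (subst nn_integral_cmult) simp_all
  qed
  also have "\<dots> = emeasure N A * emeasure M (uminus -` B)"
    by (subst nn_integral_multc) (auto simp: sets_N)
  finally show ?thesis .
qed

lemma sigma_finite_measure_if_balls_finite:
  fixes M :: "'a::real_normed_vector measure"
  assumes "sets M = sets borel" "\<And>n::nat. emeasure M (ball 0 (real n)) < \<infinity>"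
  shows "sigma_finite_measure M"
proof
  show "\<exists>A. countable A \<and> A \<subseteq> sets M \<and> \<Union>A = space M \<and> (\<forall>a\<in>A. emeasure M a \<noteq> \<infinity>)"
    using assms sets_eq_imp_space_eq[OF assms(1)]
    by (intro exI[of _ "range (\<lambda>n::nat. ball 0 (real n))"]) (auto simp: less_top intro: reals_Archimedean2)
qed

lemma lborel_distr_linear_isometry:
  fixes T :: "'a::euclidean_space \<Rightarrow> 'a"
  assumes lin: "linear T" and iso: "\<And>x. norm (T x) = norm x"
  shows "distr lborel borel T = lborel"
proof (rule measure_eqI)
  let ?M = "distr lborel borel T"
  have [measurable]: "T \<in> borel \<rightarrow>\<^sub>M borel"
    using lin
    by (intro borel_measurable_continuous_onI linear_continuous_on linear_conv_bounded_linear[THEN iffD1])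
  have surj: "surj T"
    using lin iso by (metis linear_injective_0 norm_eq_zero linear_injective_imp_surjective)
  have translate: "distr ?M borel ((+) a) = ?M" for a
  proof -
    obtain b where b: "a = T b" using surj by auto
    have "distr ?M borel ((+) a) = distr (distr lborel borel ((+) b)) borel T"
      by (simp add: distr_distr b linear_add[OF lin] o_def)
    then show ?thesis by (simp add: lborel_distr_plus)
  qed
  have emeasure_ball: "emeasure ?M (ball 0 e) = emeasure lborel (ball (0::'a) e)" for e
  proof -
    have "T -` ball 0 e = ball 0 e" by (auto simp: iso)
    then show ?thesis by (simp add: emeasure_distr)
  qed
  have sigma_finite: "sigma_finite_measure ?M"
    using emeasure_lborel_ball_finite[of "0::'a"]
    by (intro sigma_finite_measure_if_balls_finite) (simp_all add: emeasure_ball)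
  fix A assume "A \<in> sets ?M"
  moreover have "uminus -` ball (0::'a) 1 = ball 0 1" by auto
  ultimately have "emeasure lborel (ball (0::'a) 1) * emeasure ?M A
      = emeasure lborel (ball (0::'a) 1) * emeasure lborel A"
    using translation_invariant_measures_proportional[OF sigma_finite lborel.sigma_finite_measure_axioms
        _ _ translate lborel_distr_plus, of A "ball 0 1"]
    by (simp add: emeasure_ball mult.commute)
  moreover have "emeasure lborel (ball (0::'a) 1) \<noteq> 0" "emeasure lborel (ball (0::'a) 1) \<noteq> \<infinity>"
    using content_ball_pos[of 1 "0::'a"] emeasure_lborel_ball_finite[of "0::'a" 1] by (auto simp: measure_def)
  ultimately show "emeasure ?M A = emeasure lborel A"
    by (simp add: ennreal_mult_cancel_left)
qed simp

lemma nn_integral_lborel_rotate: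
  fixes g :: "complex^'n \<Rightarrow> ennreal"
  assumes [measurable]: "g \<in> borel_measurable borel"
  shows "(\<integral>\<^sup>+z. g (cis \<theta> *s z) \<partial>lborel) = (\<integral>\<^sup>+z. g z \<partial>lborel)"
proof -
  have lin: "linear (\<lambda>z::complex^'n. cis \<theta> *s z)"
    by (rule linearI) (auto simp: vec_eq_iff algebra_simps scaleR_conv_of_real)
  have [measurable]: "(\<lambda>z::complex^'n. cis \<theta> *s z) \<in> borel \<rightarrow>\<^sub>M borel"
    by (intro borel_measurable_continuous_onI continuous_intros)
  have "(\<integral>\<^sup>+z. g z \<partial>distr lborel borel (\<lambda>z. cis \<theta> *s z)) = (\<integral>\<^sup>+z. g (cis \<theta> *s z) \<partial>lborel)"
    by (subst nn_integral_distr) auto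
  then show ?thesis
    by (simp add: lborel_distr_linear_isometry[OF lin] norm_vector_smult)
qed

lemma measurable_circle_map:
  fixes a :: "complex^'n"
  shows "(\<lambda>p. a + cis (fst p) *s snd p) \<in> uniform_angle \<Otimes>\<^sub>M lborel \<rightarrow>\<^sub>M borel"
proof -
  have "continuous_on UNIV (\<lambda>p::real \<times> (complex^'n). a + cis (fst p) *s snd p)"
    by (intro continuous_intros)
  from borel_measurable_continuous_onI[OF this] show ?thesis
    by (simp add: borel_prod[symmetric] cong: measurable_cong_sets sets_pair_measure_cong)
qed

lemma nn_integral_ball_le_of_circle_supermean:
  fixes g :: "complex^'n \<Rightarrow> ennreal"
  assumes g [measurable]: "g \<in> borel_measurable borel"
    and supermean: "\<And>b. norm b < R \<Longrightarrow> (\<integral>\<^sup>+\<theta>. g (a + cis \<theta> *s b) \<partial>uniform_angle) \<le> g a"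
  shows "(\<integral>\<^sup>+z\<in>ball a R. g z \<partial>lborel) \<le> emeasure lborel (ball a R) * g a"
proof -
  let ?ball = "indicator (ball (0::complex^'n) R) :: _ \<Rightarrow> ennreal"
  interpret pair_sigma_finite uniform_angle "lborel :: (complex^'n) measure" ..
  have shifted_ball: "indicator (ball a R) (a + z) = ?ball z" for z
    by (auto simp: indicator_def dist_norm)
  have rotated_ball: "?ball (cis \<theta> *s z) = ?ball z" for \<theta> z
    by (auto simp: indicator_def norm_vector_smult)
  have ball: "?ball \<in> borel_measurable borel"
    by (intro borel_measurable_indicator borel_open open_ball)
  have joint: "(\<lambda>(\<theta>, z). g (a + cis \<theta> *s z) * ?ball z) \<in> borel_measurable (uniform_angle \<Otimes>\<^sub>M lborel)"
    unfolding case_prod_beta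
    by (intro borel_measurable_times_ennreal measurable_compose[OF measurable_circle_map g]
        measurable_compose[OF _ ball]) measurable
  have "(\<integral>\<^sup>+z\<in>ball a R. g z \<partial>lborel) = (\<integral>\<^sup>+z. g (a + z) * indicator (ball a R) (a + z) \<partial>lborel)"
    by (intro nn_integral_translate[OF lborel_distr_plus sets_lborel, symmetric])
       (simp add: borel_measurable_times_ennreal borel_measurable_indicator)
  also have "\<dots> = (\<integral>\<^sup>+\<theta>. (\<integral>\<^sup>+z. g (a + z) * ?ball z \<partial>lborel) \<partial>uniform_angle)"
    by (simp add: shifted_ball uniform_angle.emeasure_space_1[simplified])
  also have "\<dots> = (\<integral>\<^sup>+\<theta>. (\<integral>\<^sup>+z. g (a + cis \<theta> *s z) * ?ball z \<partial>lborel) \<partial>uniform_angle)"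
  proof (rule nn_integral_cong)
    have "(\<lambda>z. g (a + z) * ?ball z) \<in> borel_measurable borel"
      by (intro borel_measurable_times_ennreal ball) measurable
    from nn_integral_lborel_rotate[OF this, symmetric]
    show "(\<integral>\<^sup>+z. g (a + z) * ?ball z \<partial>lborel) = (\<integral>\<^sup>+z. g (a + cis \<theta> *s z) * ?ball z \<partial>lborel)" for \<theta>
      by (simp only: rotated_ball)
  qed
  also have "\<dots> = (\<integral>\<^sup>+z. (\<integral>\<^sup>+\<theta>. g (a + cis \<theta> *s z) * ?ball z \<partial>uniform_angle) \<partial>lborel)"
    by (rule Fubini'[OF joint, symmetric])
  also have "\<dots> \<le> (\<integral>\<^sup>+z. g a * ?ball z \<partial>lborel)"
    by (intro nn_integral_mono) (use supermean in \<open>auto simp: indicator_def\<close>)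
  also have "\<dots> = emeasure lborel (ball a R) * g a"
    by (cases "0 \<le> R") (simp_all add: nn_integral_cmult_indicator emeasure_ball ball_empty mult.commute)
  finally show ?thesis .
qed

lemma homogeneous_psh_nn_integral_neglog_ball_le:
  assumes f: "homogeneous_psh lam f" and less_1: "\<And>z. z \<in> ball a R \<Longrightarrow> f z < 1"
  shows "(\<integral>\<^sup>+z\<in>ball a R. neglog (f z) \<partial>lborel) \<le> emeasure lborel (ball a R) * neglog (f a)"
proof (rule nn_integral_ball_le_of_circle_supermean)
  show "(\<lambda>z. neglog (f z)) \<in> borel_measurable borel"
    using borel_measurable_usc[OF homogeneous_psh_usc[OF f]] by measurable
  show "(\<integral>\<^sup>+\<theta>. neglog (f (a + cis \<theta> *s b)) \<partial>uniform_angle) \<le> neglog (f a)" if "norm b < R" for b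
    using that
    by (intro homogeneous_psh_neglog_supermean[OF f] less_1) (simp add: dist_norm norm_vector_smult)
qed

lemma nn_integral_neglog_zero_on_ball:
  fixes f :: "'a::euclidean_space \<Rightarrow> real"
  assumes r: "0 < r" and zero: "\<And>z. z \<in> ball a r \<Longrightarrow> f z = 0"
  shows "(\<integral>\<^sup>+z\<in>ball a r. neglog (f z) \<partial>lborel) = \<infinity>"
proof -
  have "(\<integral>\<^sup>+z\<in>ball a r. neglog (f z) \<partial>lborel) = (\<integral>\<^sup>+z. \<infinity> * indicator (ball a r) z \<partial>lborel)"
    using zero by (intro nn_integral_cong) (auto simp: indicator_def neglog_nonpos)
  also have "\<dots> = \<infinity> * emeasure lborel (ball a r)"
    by (rule nn_integral_cmult_indicator) simp
  also have "\<dots> = \<infinity>"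
    using content_ball_pos[OF r, of a] by (auto simp: measure_def ennreal_top_mult)
  finally show ?thesis .
qed

section \<open>Pluripolar sets\<close>

lemma lam_pluripolar_subset: "lam_pluripolar lam E \<Longrightarrow> D \<subseteq> E \<Longrightarrow> lam_pluripolar lam D"
  unfolding lam_pluripolar_def by blast

lemma lam_pluripolarI:
  assumes "homogeneous_psh lam f" "f w \<noteq> 0" "\<And>z. z \<in> E \<Longrightarrow> f z = 0"
  shows "lam_pluripolar lam E"
proof -
  have "(\<lambda>z. ereal (f z)) \<in> H_lam lam" using assms(1,2) H_lam_iff by blast
  then show ?thesis
    unfolding lam_pluripolar_def by (rule bexI[rotated]) (auto simp: assms(3) zero_ereal_def)
qed

lemma homogeneous_psh_zero_if_zero_on_ball:
  assumes f: "homogeneous_psh lam f" and r: "0 < r" and zero: "\<And>z. z \<in> ball a r \<Longrightarrow> f z = 0"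
  shows "f w = 0"
proof -
  define R where "R = dist w a + r"
  have ball_subset: "ball a r \<subseteq> ball w R"
  proof
    fix z assume "z \<in> ball a r"
    then show "z \<in> ball w R" using dist_triangle[of w z a] by (simp add: R_def)
  qed
  obtain K where "K > 0" and K: "\<And>z. z \<in> cball w R \<Longrightarrow> f z < K"
    using usc_less_on_compact[OF homogeneous_psh_usc[OF f] compact_cball] by metis
  have less_1: "inverse K * f z < 1" if "z \<in> ball w R" for z
    using K[of z] that \<open>K > 0\<close> by (simp add: field_simps)
  have "\<infinity> = (\<integral>\<^sup>+z\<in>ball a r. neglog (inverse K * f z) \<partial>lborel)"
    by (rule nn_integral_neglog_zero_on_ball[OF r, symmetric]) (simp add: zero)
  also have "\<dots> \<le> (\<integral>\<^sup>+z\<in>ball w R. neglog (inverse K * f z) \<partial>lborel)"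
    using ball_subset by (intro nn_integral_mono mult_left_mono) (auto simp: indicator_def)
  also have "\<dots> \<le> emeasure lborel (ball w R) * neglog (inverse K * f w)"
    using \<open>K > 0\<close>
    by (intro homogeneous_psh_nn_integral_neglog_ball_le[where lam = lam] homogeneous_psh_cmult f less_1) auto
  finally have "neglog (inverse K * f w) = \<infinity>"
    using emeasure_lborel_ball_finite[of w R] by (auto simp: top_unique ennreal_mult_eq_top_iff)
  then show ?thesis
    using \<open>K > 0\<close> homogeneous_psh_nonneg[OF f, of w] by (simp add: neglog_eq_top_iff mult_le_0_iff)
qed

lemma not_lam_pluripolar_ball:
  assumes r: "0 < r" and subset: "ball a r \<subseteq> E"
  shows "\<not> lam_pluripolar lam E"
proof
  assume "lam_pluripolar lam E"
  then obtain f where f: "homogeneous_psh lam f" "\<exists>z. f z \<noteq> 0" "E \<subseteq> {z. f z = 0}"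
    unfolding lam_pluripolar_def Bex_def H_lam_iff by (auto simp: zero_ereal_def)
  have "f w = 0" for w
    by (rule homogeneous_psh_zero_if_zero_on_ball[OF f(1) r]) (use subset f(3) in blast)
  with f(2) show False by blast
qed

lemma not_lam_pluripolar_if_bounded_on_ball:
  fixes u :: "complex^'n \<Rightarrow> ereal"
  assumes "0 < r" "(SUP z\<in>ball a r. u z) < \<infinity>"
  shows "\<not> lam_pluripolar lam {z. u z < \<infinity>}"
proof (rule not_lam_pluripolar_ball[OF assms(1)])
  show "ball a r \<subseteq> {z. u z < \<infinity>}"
    using SUP_upper[of _ "ball a r" u] le_less_trans[OF _ assms(2)] by blast
qed

section \<open>Weighted geometric means\<close>

definition convex_weights :: "'i set \<Rightarrow> ('i \<Rightarrow> real) \<Rightarrow> bool" where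
  "convex_weights J \<alpha> \<longleftrightarrow> finite J \<and> (\<forall>j\<in>J. 0 < \<alpha> j) \<and> (\<Sum>j\<in>J. \<alpha> j) = 1"

definition geometric_mean :: "'i set \<Rightarrow> ('i \<Rightarrow> real) \<Rightarrow> ('i \<Rightarrow> real) \<Rightarrow> real" where
  "geometric_mean J \<alpha> x = (\<Prod>j\<in>J. x j powr \<alpha> j)"

lemma geometric_mean_nonneg: "0 \<le> geometric_mean J \<alpha> x"
  by (simp add: geometric_mean_def prod_nonneg)

lemma geometric_mean_const:
  assumes "convex_weights J \<alpha>" "0 < c"
  shows "geometric_mean J \<alpha> (\<lambda>_. c) = c"
  using assms powr_sum[of c \<alpha> J] by (simp add: geometric_mean_def convex_weights_def)

lemma geometric_mean_cmult:
  assumes "convex_weights J \<alpha>" "0 < c" "\<And>j. j \<in> J \<Longrightarrow> 0 \<le> x j"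
  shows "geometric_mean J \<alpha> (\<lambda>j. c * x j) = c * geometric_mean J \<alpha> x"
proof -
  have "geometric_mean J \<alpha> (\<lambda>j. c * x j) = geometric_mean J \<alpha> (\<lambda>_. c) * geometric_mean J \<alpha> x"
    using assms(2,3) by (simp add: geometric_mean_def powr_mult prod.distrib)
  then show ?thesis by (simp add: geometric_mean_const assms)
qed

lemma geometric_mean_le_1:
  assumes "convex_weights J \<alpha>" "\<And>j. j \<in> J \<Longrightarrow> 0 \<le> x j" "\<And>j. j \<in> J \<Longrightarrow> x j \<le> 1"
  shows "geometric_mean J \<alpha> x \<le> 1"
  unfolding geometric_mean_def using assms
  by (intro prod_le_1) (auto simp: convex_weights_def powr_le1 less_imp_le)

lemma neglog_prod:
  assumes "\<And>j. j \<in> J \<Longrightarrow> 0 \<le> y j" "\<And>j. j \<in> J \<Longrightarrow> y j \<le> 1"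
  shows "neglog (\<Prod>j\<in>J. y j) = (\<Sum>j\<in>J. neglog (y j))"
  using assms
  by (induction J rule: infinite_finite_induct) (auto simp: neglog_mult neglog_pos prod_nonneg prod_le_1)

lemma neglog_geometric_mean:
  assumes "convex_weights J \<alpha>" "\<And>j. j \<in> J \<Longrightarrow> 0 \<le> x j" "\<And>j. j \<in> J \<Longrightarrow> x j \<le> 1"
  shows "neglog (geometric_mean J \<alpha> x) = (\<Sum>j\<in>J. ennreal (\<alpha> j) * neglog (x j))"
proof -
  have "neglog (geometric_mean J \<alpha> x) = (\<Sum>j\<in>J. neglog (x j powr \<alpha> j))"
    unfolding geometric_mean_def using assms
    by (intro neglog_prod) (auto simp: convex_weights_def powr_le1 less_imp_le)
  then show ?thesis
    using assms by (simp add: neglog_powr convex_weights_def)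
qed

text \<open>Jensen's inequality for \<open>- ln\<close>, from its tangent line at \<open>x\<close>.\<close>

lemma (in prob_space) le_expectation_if_nn_integral_neglog_le:
  assumes X: "X \<in> borel_measurable M" "\<And>\<omega>. 0 \<le> X \<omega>" "\<And>\<omega>. X \<omega> \<le> 1"
    and neglog_le: "(\<integral>\<^sup>+\<omega>. neglog (X \<omega>) \<partial>M) \<le> neglog x" and x: "x \<le> 1"
  shows "x \<le> expectation X"
proof (cases "0 < x")
  case True
  have tangent: "ennreal x + ennreal x * neglog x \<le> ennreal (X \<omega>) + ennreal x * neglog (X \<omega>)" for \<omega>
  proof (cases "X \<omega> = 0")
    case False
    then have pos: "0 < X \<omega>" using X(2)[of \<omega>] by simp
    have "ln (X \<omega> / x) \<le> X \<omega> / x - 1" using pos True by (intro ln_le_minus_one) simp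
    then have "x + x * - ln x \<le> X \<omega> + x * - ln (X \<omega>)"
      using pos True by (simp add: ln_div field_simps)
    from ennreal_leI[OF this]
    have "ennreal x + ennreal (x * - ln x) \<le> ennreal (X \<omega>) + ennreal (x * - ln (X \<omega>))"
      using pos True x X(3)[of \<omega>] mult_nonneg_nonneg[of x "- ln x"] mult_nonneg_nonneg[of x "- ln (X \<omega>)"]
      by (subst (asm) (1 2) ennreal_plus) simp_all
    then show ?thesis
      using True by (simp only: neglog_pos[OF True] neglog_pos[OF pos] ennreal_mult' less_imp_le)
  qed (use True in \<open>simp add: neglog_def ennreal_mult_top\<close>)
  have "ennreal x + ennreal x * neglog x = (\<integral>\<^sup>+\<omega>. ennreal x + ennreal x * neglog x \<partial>M)"
    by (simp add: emeasure_space_1)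
  also have "\<dots> \<le> (\<integral>\<^sup>+\<omega>. ennreal (X \<omega>) + ennreal x * neglog (X \<omega>) \<partial>M)"
    by (intro nn_integral_mono tangent)
  also have "\<dots> = (\<integral>\<^sup>+\<omega>. ennreal (X \<omega>) \<partial>M) + ennreal x * (\<integral>\<^sup>+\<omega>. neglog (X \<omega>) \<partial>M)"
    using X(1) by (subst nn_integral_add) (auto simp: nn_integral_cmult)
  also have "\<dots> \<le> (\<integral>\<^sup>+\<omega>. ennreal (X \<omega>) \<partial>M) + ennreal x * neglog x"
    using neglog_le by (intro add_left_mono mult_left_mono) auto
  also have "(\<integral>\<^sup>+\<omega>. ennreal (X \<omega>) \<partial>M) = ennreal (expectation X)"
    using X by (intro nn_integral_eq_integral integrable_const_bound[of _ 1]) auto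
  finally have "ennreal x \<le> ennreal (expectation X)"
    using True by (simp add: neglog_pos ennreal_mult_eq_top_iff)
  then show ?thesis using X(2) by (simp add: ennreal_le_iff)
next
  case False
  moreover have "0 \<le> expectation X" using X(2) by simp
  ultimately show ?thesis by linarith
qed

lemma homogeneous_geometric_mean:
  assumes \<alpha>: "convex_weights J \<alpha>" and f: "\<And>j. j \<in> J \<Longrightarrow> homogeneous lam (f j)" "\<And>j z. j \<in> J \<Longrightarrow> 0 \<le> f j z"
  shows "homogeneous lam (\<lambda>z. geometric_mean J \<alpha> (\<lambda>j. f j z))"
proof -
  have "geometric_mean J \<alpha> (\<lambda>j. f j (Phi lam z t)) = geometric_mean J \<alpha> (\<lambda>j. exp (- Re t) * f j z)" for z t
    unfolding geometric_mean_def by (intro prod.cong) (simp_all add: homogeneousD[OF f(1)])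
  then show ?thesis
    by (simp add: homogeneous_def geometric_mean_cmult[OF \<alpha>] f(2))
qed

lemma geometric_mean_le_circle_average_if_less_1:
  assumes \<alpha>: "convex_weights J \<alpha>" and f: "\<And>j. j \<in> J \<Longrightarrow> homogeneous_psh lam (f j)"
    and less_1: "\<And>j z. j \<in> J \<Longrightarrow> z \<in> cball 0 (norm a + norm b) \<Longrightarrow> f j z < 1"
  shows "geometric_mean J \<alpha> (\<lambda>j. f j a) \<le> circle_average (\<lambda>z. geometric_mean J \<alpha> (\<lambda>j. f j z)) a b"
    (is "?m a \<le> _")
proof -
  let ?c = "\<lambda>\<theta>. a + cis \<theta> *s b"
  have f_range: "0 \<le> f j z" "f j (?c \<theta>) < 1" "f j a < 1" if "j \<in> J" for j z \<theta>
    using homogeneous_psh_nonneg[OF f[OF that]] less_1[OF that circle_in_cball] less_1[OF that, of a]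
    by simp_all
  have meas: "(\<lambda>\<theta>. f j (?c \<theta>)) \<in> borel_measurable borel" if "j \<in> J" for j
    by (rule usc_circle_measurable[OF homogeneous_psh_usc[OF f[OF that]]])
  have "(\<integral>\<^sup>+\<theta>. neglog (?m (?c \<theta>)) \<partial>uniform_angle)
      = (\<integral>\<^sup>+\<theta>. (\<Sum>j\<in>J. ennreal (\<alpha> j) * neglog (f j (?c \<theta>))) \<partial>uniform_angle)"
    using f_range by (simp add: neglog_geometric_mean[OF \<alpha>] less_imp_le)
  also have "\<dots> = (\<Sum>j\<in>J. ennreal (\<alpha> j) * (\<integral>\<^sup>+\<theta>. neglog (f j (?c \<theta>)) \<partial>uniform_angle))"
    using meas by (simp add: nn_integral_sum nn_integral_cmult)
  also have "\<dots> \<le> (\<Sum>j\<in>J. ennreal (\<alpha> j) * neglog (f j a))"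
    by (intro sum_mono mult_left_mono homogeneous_psh_neglog_supermean[where lam = lam] f f_range(2)) auto
  also have "\<dots> = neglog (?m a)"
    using f_range by (simp add: neglog_geometric_mean[OF \<alpha>] less_imp_le)
  finally show ?thesis
    unfolding circle_average_def
  proof (intro uniform_angle.le_expectation_if_nn_integral_neglog_le geometric_mean_nonneg
      geometric_mean_le_1[OF \<alpha>])
    show "(\<lambda>\<theta>. ?m (?c \<theta>)) \<in> borel_measurable uniform_angle"
      unfolding geometric_mean_def using meas by measurable
  qed (use f_range in \<open>auto simp: less_imp_le\<close>)
qed

lemma nonneg_psh_geometric_mean:
  fixes f :: "'i \<Rightarrow> complex^'n \<Rightarrow> real"
  assumes \<alpha>: "convex_weights J \<alpha>" and f: "\<And>j. j \<in> J \<Longrightarrow> homogeneous_psh lam (f j)"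
  shows "nonneg_psh (\<lambda>z. geometric_mean J \<alpha> (\<lambda>j. f j z))" (is "nonneg_psh ?m")
  unfolding nonneg_psh_def
proof (intro conjI allI geometric_mean_nonneg)
  show "usc ?m"
    unfolding geometric_mean_def using homogeneous_pshD[OF f] \<alpha>
    by (intro usc_prod_nonneg usc_powr) (auto simp: convex_weights_def)
  fix a b :: "complex^'n"
  have "finite J" using \<alpha> by (simp add: convex_weights_def)
  then obtain K where K: "K > 0" "\<And>j z. j \<in> J \<Longrightarrow> z \<in> cball 0 (norm a + norm b) \<Longrightarrow> f j z < K"
    using usc_finite_family_less_on_compact[where f = f, OF _ homogeneous_psh_usc[OF f] compact_cball]
    by blast
  have "geometric_mean J \<alpha> (\<lambda>j. inverse K * f j a)
      \<le> circle_average (\<lambda>z. geometric_mean J \<alpha> (\<lambda>j. inverse K * f j z)) a b"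
    using K
    by (intro geometric_mean_le_circle_average_if_less_1[OF \<alpha>, where lam = lam] homogeneous_psh_cmult f)
       (auto simp: field_simps)
  moreover have "geometric_mean J \<alpha> (\<lambda>j. inverse K * f j z) = inverse K * ?m z" for z
    using K(1) homogeneous_psh_nonneg[OF f] by (intro geometric_mean_cmult[OF \<alpha>]) auto
  ultimately show "?m a \<le> circle_average ?m a b"
    using K(1) by (simp add: circle_average_def)
qed

lemma homogeneous_psh_geometric_mean:
  assumes "convex_weights J \<alpha>" "\<And>j. j \<in> J \<Longrightarrow> homogeneous_psh lam (f j)"
  shows "homogeneous_psh lam (\<lambda>z. geometric_mean J \<alpha> (\<lambda>j. f j z))"
  unfolding homogeneous_psh_def
proof
  show "nonneg_psh (\<lambda>z. geometric_mean J \<alpha> (\<lambda>j. f j z))"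
    using assms by (rule nonneg_psh_geometric_mean)
  show "homogeneous lam (\<lambda>z. geometric_mean J \<alpha> (\<lambda>j. f j z))"
    using homogeneous_pshD[OF assms(2)] by (intro homogeneous_geometric_mean[OF assms(1)])
qed

section \<open>Regularized suprema of bounded families\<close>

lemma Phi_maps_cball_into_unit_ball:
  fixes lam :: "real^'n"
  assumes lam: "\<forall>k. lam$k > 0"
  obtains t where "\<And>z. z \<in> cball 0 R \<Longrightarrow> Phi lam z (of_real t) \<in> ball 0 1"
proof -
  define c where "c = inverse (\<bar>R\<bar> + 1)"
  have "c > 0" by (simp add: c_def)
  have "\<forall>\<^sub>F t in at_top. \<forall>k. exp (- (lam$k * t)) < c"
  proof (rule eventually_all_finite)
    fix k
    have "0 < lam$k" using lam by blast
    then have "((\<lambda>t. exp (- (lam$k * t))) \<longlongrightarrow> 0) at_top" by real_asymp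
    then show "\<forall>\<^sub>F t in at_top. exp (- (lam$k * t)) < c"
      using \<open>c > 0\<close> by (rule order_tendstoD)
  qed
  from eventually_happens[OF this] obtain t where t: "\<And>k. exp (- (lam$k * t)) < c"
    by auto
  have "Phi lam z (of_real t) \<in> ball 0 1" if "z \<in> cball 0 R" for z
  proof -
    have "norm (Phi lam z (of_real t)) \<le> norm (of_real c *s z)"
    proof (rule norm_le_componentwise_cart)
      show "norm (Phi lam z (of_real t) $ k) \<le> norm ((of_real c *s z) $ k)" for k
        using mult_right_mono[OF less_imp_le[OF t[of k]], of "cmod (z$k)"] \<open>c > 0\<close>
        by (simp add: Phi_def norm_mult mult.commute)
    qed
    also have "\<dots> \<le> c * \<bar>R\<bar>"
      using that \<open>c > 0\<close> by (simp add: norm_vector_smult)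
    also have "\<dots> < 1" by (simp add: c_def field_simps)
    finally show ?thesis by simp
  qed
  then show ?thesis by (rule that)
qed

lemma homogeneous_family_locally_bounded:
  fixes lam :: "real^'n"
  assumes lam: "\<forall>k. lam$k > 0" and f: "\<And>i. i \<in> I \<Longrightarrow> homogeneous lam (f i)"
    and bound: "\<And>i z. i \<in> I \<Longrightarrow> z \<in> ball 0 1 \<Longrightarrow> f i z \<le> M"
  obtains K where "\<And>i z. i \<in> I \<Longrightarrow> z \<in> cball 0 R \<Longrightarrow> f i z \<le> K"
proof -
  obtain t where t: "\<And>z. z \<in> cball 0 R \<Longrightarrow> Phi lam z (of_real t) \<in> ball 0 1"
    using Phi_maps_cball_into_unit_ball[OF lam] by blast
  have "f i z \<le> exp t * M" if "i \<in> I" "z \<in> cball 0 R" for i z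
    using bound[OF that(1) t[OF that(2)]] homogeneousD[OF f[OF that(1)], of z "of_real t"]
    by (simp add: exp_minus field_simps)
  then show ?thesis by (rule that)
qed

lemma SUP_less_top_imp_real_bound:
  fixes u :: "'a \<Rightarrow> ereal"
  assumes "(SUP z\<in>B. u z) < \<infinity>"
  obtains M where "\<And>z. z \<in> B \<Longrightarrow> u z \<le> ereal M"
proof -
  obtain M where "(SUP z\<in>B. u z) < ereal M"
    using assms less_PInf_Ex_of_nat by auto
  then show ?thesis using that SUP_upper order_trans less_imp_le by metis
qed

lemma homogeneous_psh_regularized_SUP:
  fixes f :: "'i \<Rightarrow> complex^'n \<Rightarrow> real"
  assumes I: "I \<noteq> {}" and f: "\<And>i. i \<in> I \<Longrightarrow> homogeneous_psh lam (f i)"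
    and h: "usc_reg (\<lambda>z. SUP i\<in>I. ereal (f i z)) = (\<lambda>z. ereal (h z))"
  shows "homogeneous_psh lam h"
proof -
  note h_usc = usc_reg_SUP_ereal_usc[OF h] and f_le_h = usc_reg_SUP_ereal_upper[OF h]
    and h_least = usc_reg_SUP_ereal_least[OF h]
  have h_nonneg: "0 \<le> h z" for z
    using I homogeneous_psh_nonneg[OF f] f_le_h order_trans by blast
  have "h a \<le> circle_average h a b" for a b
  proof (rule h_least)
    show "usc (\<lambda>a. circle_average h a b)" by (rule usc_circle_average[OF h_usc h_nonneg])
    show "f i a \<le> circle_average h a b" if "i \<in> I" for i a
    proof -
      have "f i a \<le> circle_average (f i) a b"
        by (rule nonneg_psh_le_circle_average[OF homogeneous_psh_nonneg_psh[OF f[OF that]]])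
      also have "\<dots> \<le> circle_average h a b"
        using homogeneous_pshD[OF f[OF that]] by (intro circle_average_mono h_usc f_le_h that)
      finally show ?thesis .
    qed
  qed
  moreover have h_le: "h z \<le> exp (Re t) * h (Phi lam z t)" for z t
  proof (rule h_least)
    show "usc (\<lambda>z. exp (Re t) * h (Phi lam z t))"
      by (intro usc_mult_nonneg usc_const usc_compose[OF h_usc continuous_on_Phi]) (auto simp: h_nonneg)
    show "f i z \<le> exp (Re t) * h (Phi lam z t)" if "i \<in> I" for i z
      using f_le_h[OF that, of "Phi lam z t"]
        homogeneousD[OF homogeneous_psh_homogeneous[OF f[OF that]], of z t]
      by (simp add: exp_minus field_simps)
  qed
  have "h (Phi lam z t) = exp (- Re t) * h z" for z t
    using h_le[of z t] h_le[of "Phi lam z t" "- t"] by (simp add: exp_minus field_simps)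
  ultimately show "homogeneous_psh lam h"
    using h_usc h_nonneg by (simp add: homogeneous_psh_def nonneg_psh_def homogeneous_def)
qed

lemma bounded_family_regularized_SUP:
  fixes f :: "'i \<Rightarrow> complex^'n \<Rightarrow> real"
  assumes lam: "\<forall>k. lam$k > 0" and I: "I \<noteq> {}"
    and f: "\<And>i. i \<in> I \<Longrightarrow> homogeneous_psh lam (f i)"
    and bound: "\<And>i z. i \<in> I \<Longrightarrow> z \<in> ball 0 1 \<Longrightarrow> f i z \<le> M"
  obtains h where "usc_reg (\<lambda>z. SUP i\<in>I. ereal (f i z)) = (\<lambda>z. ereal (h z))"
    "homogeneous_psh lam h" "\<And>i z. i \<in> I \<Longrightarrow> f i z \<le> h z"
proof -
  let ?u = "\<lambda>z. SUP i\<in>I. ereal (f i z)"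
  have "usc_reg ?u a < \<infinity>" for a
  proof -
    obtain K where K: "\<And>i z. i \<in> I \<Longrightarrow> z \<in> cball 0 (norm a + 1) \<Longrightarrow> f i z \<le> K"
      using homogeneous_family_locally_bounded[where f = f, OF lam homogeneous_psh_homogeneous[OF f] bound]
      by blast
    have "ball a 1 \<subseteq> cball 0 (norm a + 1)"
      by (simp add: ball_subset_cball_iff)
    then have "(SUP z\<in>ball a 1. ?u z) \<le> ereal K" using K by (intro SUP_least) auto
    then show ?thesis
      unfolding usc_reg_less_top_iff using le_less_trans[of _ "ereal K"] by (intro exI[of _ 1]) auto
  qed
  moreover have "0 \<le> usc_reg ?u a" for a
  proof -
    obtain i where i: "i \<in> I" using I by blast
    have "0 \<le> ereal (f i a)" using homogeneous_psh_nonneg[OF f[OF i]] by simp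
    also have "\<dots> \<le> ?u a" using i by (rule SUP_upper)
    also have "\<dots> \<le> usc_reg ?u a" by (rule le_usc_reg)
    finally show ?thesis .
  qed
  ultimately have h: "usc_reg ?u = (\<lambda>z. ereal (real_of_ereal (usc_reg ?u z)))"
    by (intro ext ereal_real'[symmetric]) (auto simp: less_top)
  show ?thesis
    by (rule that[OF h homogeneous_psh_regularized_SUP[OF I f h] usc_reg_SUP_ereal_upper[OF h]])
qed

lemma usc_reg_SUP_in_H_lam:
  fixes lam :: "real^'n" and f :: "'i \<Rightarrow> complex^'n \<Rightarrow> real"
  assumes lam: "\<forall>k. lam$k > 0" and I: "I \<noteq> {}"
    and f: "\<And>i. i \<in> I \<Longrightarrow> homogeneous_psh lam (f i)" "\<And>i. i \<in> I \<Longrightarrow> \<exists>z. f i z \<noteq> 0"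
    and bounded: "(SUP z\<in>ball 0 1. SUP i\<in>I. ereal (f i z)) < \<infinity>"
  shows "usc_reg (\<lambda>z. SUP i\<in>I. ereal (f i z)) \<in> H_lam lam"
proof -
  obtain M where "\<And>z. z \<in> ball 0 1 \<Longrightarrow> (SUP i\<in>I. ereal (f i z)) \<le> ereal M"
    using SUP_less_top_imp_real_bound[OF bounded] by blast
  then have "f i z \<le> M" if "i \<in> I" "z \<in> ball 0 1" for i z
    using that by (simp add: SUP_le_iff)
  then obtain h where h: "usc_reg (\<lambda>z. SUP i\<in>I. ereal (f i z)) = (\<lambda>z. ereal (h z))"
    "homogeneous_psh lam h" "\<And>i z. i \<in> I \<Longrightarrow> f i z \<le> h z"
    using bounded_family_regularized_SUP[where f = f, OF lam I f(1)] by blast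
  obtain i z where i: "i \<in> I" "f i z \<noteq> 0" using I f(2) by blast
  then have "0 < h z"
    using homogeneous_psh_nonneg[OF f(1)[OF i(1)], of z] h(3)[OF i(1), of z] by linarith
  then have "\<exists>z. h z \<noteq> 0" by (intro exI[of _ z]) simp
  then show ?thesis unfolding h(1) H_lam_iff using h(2) by blast
qed

section \<open>Infinite geometric means\<close>

definition dyadic_weight :: "nat \<Rightarrow> nat \<Rightarrow> real" where
  "dyadic_weight m j = (if j = m then (1/2)^m else (1/2)^(j+1))"

lemma convex_weights_dyadic: "convex_weights {..m} (dyadic_weight m)"
proof -
  have "(\<Sum>j\<le>m. dyadic_weight m j) = (\<Sum>j<m. (1/2)^(j+1)) + (1/2)^m"
    by (simp add: dyadic_weight_def lessThan_Suc_atMost[symmetric])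
  also have "\<dots> = 1" by (induction m) (auto simp: field_simps)
  finally show ?thesis by (simp add: convex_weights_def dyadic_weight_def)
qed

locale dominated_sequence =
  fixes lam :: "real^'n" and f :: "nat \<Rightarrow> complex^'n \<Rightarrow> real" and h :: "complex^'n \<Rightarrow> real"
  assumes f_psh: "\<And>j. homogeneous_psh lam (f j)" and h_psh: "homogeneous_psh lam h"
    and f_le_h: "\<And>j z. f j z \<le> h z"
begin

text \<open>The remaining weight \<open>2\<^sup>-\<^sup>m\<close> is put on the majorant \<open>h\<close>, which makes the means decreasing and
  homogeneous of the same degree.\<close>

definition partial_mean :: "nat \<Rightarrow> complex^'n \<Rightarrow> real" where
  "partial_mean m z = geometric_mean {..m} (dyadic_weight m) (\<lambda>j. (f(m := h)) j z)"

definition limit_mean :: "complex^'n \<Rightarrow> real" where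
  "limit_mean z = (INF m. partial_mean m z)"

lemma f_nonneg: "0 \<le> f j z" and h_nonneg: "0 \<le> h z"
  using homogeneous_psh_nonneg[OF f_psh] homogeneous_psh_nonneg[OF h_psh] by auto

lemma partial_mean_eq: "partial_mean m z = (\<Prod>j<m. f j z powr (1/2)^(j+1)) * h z powr (1/2)^m"
  by (simp add: partial_mean_def geometric_mean_def dyadic_weight_def lessThan_Suc_atMost[symmetric])

lemma homogeneous_psh_partial_mean: "homogeneous_psh lam (partial_mean m)"
  unfolding partial_mean_def using f_psh h_psh
  by (intro homogeneous_psh_geometric_mean convex_weights_dyadic) simp

lemma decseq_partial_mean: "decseq (\<lambda>m. partial_mean m z)"
proof (rule decseq_SucI)
  fix m
  have "f m z powr (1/2)^(m+1) * h z powr (1/2)^(m+1) \<le> h z powr (1/2)^(m+1) * h z powr (1/2)^(m+1)"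
    using f_nonneg f_le_h by (intro mult_right_mono powr_mono2) auto
  also have "\<dots> = h z powr (1/2)^m" by (simp flip: powr_add)
  finally show "partial_mean (Suc m) z \<le> partial_mean m z"
    by (simp add: partial_mean_eq mult.assoc mult_left_mono prod_nonneg)
qed

lemma partial_mean_tendsto: "(\<lambda>m. partial_mean m z) \<longlonglongrightarrow> limit_mean z"
  unfolding limit_mean_def using homogeneous_psh_nonneg[OF homogeneous_psh_partial_mean]
  by (intro LIMSEQ_decseq_INF decseq_partial_mean bdd_belowI[of _ 0]) auto

lemma homogeneous_psh_limit_mean: "homogeneous_psh lam limit_mean"
proof -
  have "nonneg_psh limit_mean"
    using homogeneous_psh_nonneg_psh[OF homogeneous_psh_partial_mean] decseq_partial_mean partial_mean_tendsto
    by (rule nonneg_psh_decreasing_limit)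
  moreover have "limit_mean (Phi lam z t) = exp (- Re t) * limit_mean z" for z t
    using partial_mean_tendsto[of "Phi lam z t"]
      tendsto_mult_left[OF partial_mean_tendsto, of "exp (- Re t)" z]
    unfolding homogeneousD[OF homogeneous_psh_homogeneous[OF homogeneous_psh_partial_mean]]
    by (rule LIMSEQ_unique)
  ultimately show ?thesis by (simp add: homogeneous_psh_def homogeneous_def)
qed

lemma partial_mean_le:
  assumes h: "h z \<le> U" and f: "\<And>j. f j z \<le> U * exp (- (2^(j+1)))"
  shows "partial_mean m z \<le> U * exp (- real m)"
proof -
  have U: "0 \<le> U" using h_nonneg h order_trans by blast
  have "(\<Prod>j<m. f j z powr (1/2)^(j+1)) * U powr (1/2)^m \<le> U * exp (- real m)"
  proof (induction m)
    case (Suc m)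
    have "exp (- (2^(m+1))) powr (1/2::real)^(m+1) = exp (-1)"
      by (simp add: powr_def power_one_over)
    moreover have "f m z powr (1/2)^(m+1) \<le> (U * exp (- (2^(m+1)))) powr (1/2)^(m+1)"
      using f f_nonneg by (intro powr_mono2) auto
    ultimately have "f m z powr (1/2)^(m+1) \<le> U powr (1/2)^(m+1) * exp (-1)"
      using U by (simp add: powr_mult)
    then have "f m z powr (1/2)^(m+1) * U powr (1/2)^(m+1)
        \<le> U powr (1/2)^(m+1) * exp (-1) * U powr (1/2)^(m+1)"
      by (rule mult_right_mono) simp
    also have "\<dots> = U powr (1/2)^m * exp (-1)"
      by (simp add: mult_ac flip: powr_add)
    finally have "(\<Prod>j<Suc m. f j z powr (1/2)^(j+1)) * U powr (1/2)^Suc m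
        \<le> (\<Prod>j<m. f j z powr (1/2)^(j+1)) * (U powr (1/2)^m * exp (-1))"
      by (simp add: mult.assoc mult_left_mono prod_nonneg)
    also have "\<dots> \<le> U * exp (- real m) * exp (-1)"
      using mult_right_mono[OF Suc.IH, of "exp (-1)"] by (simp add: mult.assoc)
    also have "\<dots> = U * exp (- real (Suc m))" by (simp add: mult.assoc flip: exp_add)
    finally show ?case .
  qed (use U in simp)
  moreover have "h z powr (1/2)^m \<le> U powr (1/2)^m"
    using h h_nonneg by (intro powr_mono2) auto
  then have "partial_mean m z \<le> (\<Prod>j<m. f j z powr (1/2)^(j+1)) * U powr (1/2)^m"
    unfolding partial_mean_eq by (intro mult_left_mono prod_nonneg) auto
  ultimately show ?thesis by linarith
qed

lemma limit_mean_zero: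
  assumes "\<And>j. f j z \<le> U * exp (- (2^(j+1)))"
  shows "limit_mean z = 0"
proof -
  have "f j z \<le> max U (h z) * exp (- (2^(j+1)))" for j
    using assms[of j] by (rule order_trans) (intro mult_right_mono, auto)
  then have "partial_mean m z \<le> max U (h z) * exp (- real m)" for m
    by (intro partial_mean_le) auto
  moreover have "(\<lambda>m. max U (h z) * exp (- real m)) \<longlonglongrightarrow> 0" by real_asymp
  ultimately have "limit_mean z \<le> 0"
    using LIMSEQ_le[OF partial_mean_tendsto] by blast
  then show ?thesis
    using homogeneous_psh_nonneg[OF homogeneous_psh_limit_mean, of z] by linarith
qed

lemma nn_integral_neglog_partial_mean_le:
  assumes B: "B \<in> sets borel" and less_1: "\<And>z. z \<in> B \<Longrightarrow> h z < 1"
    and mass: "\<And>j. (\<integral>\<^sup>+z\<in>B. neglog (f j z) \<partial>lborel) \<le> C"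
  shows "(\<integral>\<^sup>+z\<in>B. neglog (partial_mean m z) \<partial>lborel) \<le> C"
proof -
  let ?g = "\<lambda>j. (f(m := h)) j"
  have g: "0 \<le> ?g j z" "?g j z \<le> h z" "homogeneous_psh lam (?g j)" for j z
    using f_nonneg h_nonneg f_le_h f_psh h_psh by auto
  have "(\<integral>\<^sup>+z\<in>B. neglog (h z) \<partial>lborel) \<le> (\<integral>\<^sup>+z\<in>B. neglog (f 0 z) \<partial>lborel)"
    by (intro nn_integral_mono mult_right_mono neglog_antimono f_le_h) auto
  then have g_mass: "(\<integral>\<^sup>+z\<in>B. neglog (?g j z) \<partial>lborel) \<le> C" for j
    using mass[of j] mass[of 0] by auto
  have meas: "(\<lambda>z. neglog (?g j z) * indicator B z) \<in> borel_measurable borel" for j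
    using borel_measurable_usc[OF homogeneous_psh_usc[OF g(3)]] B by measurable
  have "(\<integral>\<^sup>+z\<in>B. neglog (partial_mean m z) \<partial>lborel)
      = (\<integral>\<^sup>+z. (\<Sum>j\<le>m. ennreal (dyadic_weight m j) * (neglog (?g j z) * indicator B z)) \<partial>lborel)"
  proof (rule nn_integral_cong)
    fix z
    show "neglog (partial_mean m z) * indicator B z
        = (\<Sum>j\<le>m. ennreal (dyadic_weight m j) * (neglog (?g j z) * indicator B z))"
    proof (cases "z \<in> B")
      case True
      then have "?g j z \<le> 1" for j using g(2) less_1 by (meson less_imp_le order_trans)
      then show ?thesis
        using True unfolding partial_mean_def
        by (simp only: neglog_geometric_mean[OF convex_weights_dyadic] g) simp
    qed simp
  qed
  also have "\<dots> = (\<Sum>j\<le>m. ennreal (dyadic_weight m j) * (\<integral>\<^sup>+z\<in>B. neglog (?g j z) \<partial>lborel))"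
    using meas by (subst nn_integral_sum) (simp_all add: nn_integral_cmult)
  also have "\<dots> \<le> (\<Sum>j\<le>m. ennreal (dyadic_weight m j) * C)"
    by (intro sum_mono mult_left_mono g_mass) simp
  also have "\<dots> = ennreal (\<Sum>j\<le>m. dyadic_weight m j) * C"
    by (simp add: sum_ennreal dyadic_weight_def flip: sum_distrib_right)
  also have "\<dots> = C"
    using convex_weights_dyadic[of m] by (simp add: convex_weights_def)
  finally show ?thesis .
qed

lemma limit_mean_nonzero:
  assumes r: "0 < r" and less_1: "\<And>z. z \<in> ball a r \<Longrightarrow> h z < 1"
    and mass: "\<And>j. (\<integral>\<^sup>+z\<in>ball a r. neglog (f j z) \<partial>lborel) \<le> C" and C: "C < \<infinity>"
  shows "\<exists>z. limit_mean z \<noteq> 0"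
proof (rule ccontr)
  assume "\<not> ?thesis"
  then have "\<infinity> = (\<integral>\<^sup>+z\<in>ball a r. neglog (limit_mean z) \<partial>lborel)"
    by (intro nn_integral_neglog_zero_on_ball[OF r, symmetric]) simp
  also have "\<dots> = (\<integral>\<^sup>+z. liminf (\<lambda>m. neglog (partial_mean m z) * indicator (ball a r) z) \<partial>lborel)"
  proof (intro nn_integral_cong lim_imp_Liminf[symmetric])
    show "(\<lambda>m. neglog (partial_mean m z) * indicator (ball a r) z)
        \<longlonglongrightarrow> neglog (limit_mean z) * indicator (ball a r) z" for z
      using isCont_tendsto_compose[OF isCont_neglog partial_mean_tendsto, of z] by (cases "z \<in> ball a r") auto
  qed simp
  also have "\<dots> \<le> liminf (\<lambda>m. \<integral>\<^sup>+z\<in>ball a r. neglog (partial_mean m z) \<partial>lborel)"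
    using borel_measurable_usc[OF homogeneous_psh_usc[OF homogeneous_psh_partial_mean]]
    by (intro nn_integral_liminf borel_measurable_times_ennreal borel_measurable_indicator) simp_all
  also have "\<dots> \<le> C"
    using nn_integral_neglog_partial_mean_le[OF _ less_1 mass]
    by (intro Liminf_le always_eventually allI) auto
  finally show False using C by (simp add: top_unique)
qed

end

section \<open>Unbounded families\<close>

lemma homogeneous_psh_nn_integral_neglog_unit_ball_le:
  fixes f :: "complex^'n \<Rightarrow> real"
  assumes f: "homogeneous_psh lam f" and less_1: "\<And>z. z \<in> ball 0 3 \<Longrightarrow> f z < 1"
    and x: "norm x \<le> 1" "c \<le> f x"
  shows "(\<integral>\<^sup>+z\<in>ball 0 1. neglog (f z) \<partial>lborel) \<le> emeasure lborel (ball (0::complex^'n) 2) * neglog c"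
proof -
  have "ball 0 1 \<subseteq> ball x 2" "ball x 2 \<subseteq> ball 0 3"
    using x(1) by (simp_all add: ball_subset_ball_iff)
  then have "(\<integral>\<^sup>+z\<in>ball 0 1. neglog (f z) \<partial>lborel) \<le> (\<integral>\<^sup>+z\<in>ball x 2. neglog (f z) \<partial>lborel)"
    by (intro nn_integral_mono mult_left_mono) (auto simp: indicator_def)
  also have "\<dots> \<le> emeasure lborel (ball x 2) * neglog (f x)"
    using \<open>ball x 2 \<subseteq> ball 0 3\<close> by (intro homogeneous_psh_nn_integral_neglog_ball_le[OF f] less_1) auto
  also have "\<dots> \<le> emeasure lborel (ball (0::complex^'n) 2) * neglog c"
    using x(2) by (simp add: emeasure_ball mult_left_mono neglog_antimono)
  finally show ?thesis .
qed

lemma lam_pluripolar_normalized_sequence: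
  fixes lam :: "real^'n" and F :: "nat \<Rightarrow> complex^'n \<Rightarrow> real"
  assumes lam: "\<forall>k. lam$k > 0" and F: "\<And>j. homogeneous_psh lam (F j)"
    and F_le_1: "\<And>j z. z \<in> cball 0 1 \<Longrightarrow> F j z \<le> 1"
    and x: "\<And>j. x j \<in> cball 0 1" "\<And>j. F j (x j) = 1"
  shows "lam_pluripolar lam {z. \<exists>U. \<forall>j. F j z \<le> U * exp (- (2^(j+1)))}"
proof -
  obtain h where h: "homogeneous_psh lam h" "\<And>j z. F j z \<le> h z"
    using bounded_family_regularized_SUP[OF lam UNIV_not_empty, of F 1] F F_le_1
    by (metis UNIV_I ball_subset_cball subsetD)
  obtain K where "K > 0" and h_less: "\<And>z. z \<in> cball 0 3 \<Longrightarrow> h z < K"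
    using usc_less_on_compact[OF homogeneous_psh_usc[OF h(1)] compact_cball] by metis
  have less_1: "inverse K * h z < 1" if "z \<in> ball 0 3" for z
    using h_less[of z] that \<open>K > 0\<close> by (simp add: field_simps)
  interpret dominated_sequence lam "\<lambda>j z. inverse K * F j z" "\<lambda>z. inverse K * h z"
    using F h \<open>K > 0\<close> by unfold_locales (auto intro: homogeneous_psh_cmult)
  have "\<exists>w. limit_mean w \<noteq> 0"
  proof (rule limit_mean_nonzero[OF zero_less_one, of 0])
    let ?C = "emeasure lborel (ball (0::complex^'n) 2) * neglog (inverse K)"
    show "(\<integral>\<^sup>+z\<in>ball 0 1. neglog (inverse K * F j z) \<partial>lborel) \<le> ?C" for j
      using x
      by (intro homogeneous_psh_nn_integral_neglog_unit_ball_le[OF f_psh, where x = "x j"]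
          le_less_trans[OF f_le_h less_1]) auto
    show "?C < \<infinity>"
      using emeasure_lborel_ball_finite[of "0::complex^'n" 2] \<open>K > 0\<close>
      by (simp add: ennreal_mult_less_top neglog_pos)
  qed (use less_1 in auto)
  then obtain w where "limit_mean w \<noteq> 0" ..
  with homogeneous_psh_limit_mean show ?thesis
  proof (rule lam_pluripolarI)
    fix z assume "z \<in> {z. \<exists>U. \<forall>j. F j z \<le> U * exp (- (2^(j+1)))}"
    then obtain U where "\<And>j. F j z \<le> U * exp (- (2^(j+1)))" by blast
    then have "inverse K * F j z \<le> inverse K * (U * exp (- (2^(j+1))))" for j
      using \<open>K > 0\<close> by (intro mult_left_mono) auto
    then show "limit_mean z = 0"
      by (intro limit_mean_zero[of z "inverse K * U"]) (simp only: mult.assoc)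
  qed
qed

lemma unbounded_family_large_maximum:
  fixes f :: "'i \<Rightarrow> 'a::heine_borel \<Rightarrow> real"
  assumes f: "\<And>i. i \<in> I \<Longrightarrow> usc (f i)" and unbounded: "(SUP z\<in>ball a r. SUP i\<in>I. ereal (f i z)) = \<infinity>"
  shows "\<exists>i x. i \<in> I \<and> x \<in> cball a r \<and> (\<forall>z\<in>cball a r. f i z \<le> f i x) \<and> c \<le> f i x"
proof -
  have "ereal c < (SUP z\<in>ball a r. SUP i\<in>I. ereal (f i z))" by (simp add: unbounded)
  then obtain i z where iz: "i \<in> I" "z \<in> cball a r" "c < f i z"
    unfolding less_SUP_iff using ball_subset_cball by fastforce
  then obtain x where "x \<in> cball a r" "\<forall>z\<in>cball a r. f i z \<le> f i x"
    using usc_attains_sup[OF f compact_cball] by blast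
  with iz show ?thesis by (intro exI[of _ i] exI[of _ x]) (auto intro: order_trans less_imp_le)
qed

lemma lam_pluripolar_if_unbounded:
  fixes lam :: "real^'n" and f :: "'i \<Rightarrow> complex^'n \<Rightarrow> real"
  assumes lam: "\<forall>k. lam$k > 0" and f: "\<And>i. i \<in> I \<Longrightarrow> homogeneous_psh lam (f i)"
    and unbounded: "(SUP z\<in>ball 0 1. SUP i\<in>I. ereal (f i z)) = \<infinity>"
  shows "lam_pluripolar lam {z. (SUP i\<in>I. ereal (f i z)) < \<infinity>}"
proof -
  have "\<exists>i x. i \<in> I \<and> x \<in> cball 0 1 \<and> (\<forall>z\<in>cball 0 1. f i z \<le> f i x) \<and> exp (2^(j+1)) \<le> f i x" for j :: nat
    by (rule unbounded_family_large_maximum[OF _ unbounded]) (rule homogeneous_psh_usc[OF f])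
  then obtain i x where i: "\<And>j::nat. i j \<in> I" and x: "\<And>j. x j \<in> cball 0 1"
    and max: "\<And>j z. z \<in> cball 0 1 \<Longrightarrow> f (i j) z \<le> f (i j) (x j)"
    and large: "\<And>j. exp (2^(j+1)) \<le> f (i j) (x j)" by metis
  define M where "M = (\<lambda>j. f (i j) (x j))"
  have M_pos: "M j > 0" for j
    using less_le_trans[OF exp_gt_zero large] by (simp add: M_def)
  define F where "F = (\<lambda>j z. inverse (M j) * f (i j) z)"
  have F_psh: "homogeneous_psh lam (F j)" for j
    unfolding F_def using M_pos[of j] by (intro homogeneous_psh_cmult f i) simp
  have F_le_1: "F j z \<le> 1" if "z \<in> cball 0 1" for j z
    using max[OF that, of j] M_pos[of j] by (simp add: F_def M_def field_simps)
  have F_max: "F j (x j) = 1" for j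
    using M_pos[of j] by (simp add: F_def M_def)
  have F_le: "F j z \<le> U * exp (- (2^(j+1)))" if U: "\<And>i. i \<in> I \<Longrightarrow> f i z \<le> U" for j z U
  proof -
    have "inverse (M j) \<le> exp (- (2^(j+1)))"
      using large[of j] unfolding exp_minus M_def by (intro le_imp_inverse_le) auto
    then have "F j z \<le> exp (- (2^(j+1))) * f (i j) z"
      unfolding F_def using homogeneous_psh_nonneg[OF f[OF i]] by (rule mult_right_mono)
    also have "\<dots> \<le> exp (- (2^(j+1))) * U" using U[OF i[of j]] by simp
    finally show ?thesis by (simp add: mult.commute)
  qed
  have "{z. (SUP i\<in>I. ereal (f i z)) < \<infinity>} \<subseteq> {z. \<exists>U. \<forall>j. F j z \<le> U * exp (- (2^(j+1)))}"
  proof (intro subsetI CollectI)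
    fix z assume "z \<in> {z. (SUP i\<in>I. ereal (f i z)) < \<infinity>}"
    then obtain U where "\<And>i. i \<in> I \<Longrightarrow> ereal (f i z) \<le> ereal U"
      using SUP_less_top_imp_real_bound[of "\<lambda>i. ereal (f i z)" I] by blast
    then show "\<exists>U. \<forall>j. F j z \<le> U * exp (- (2^(j+1)))"
      by (intro exI[of _ U] allI F_le) simp
  qed
  with lam_pluripolar_normalized_sequence[OF lam F_psh F_le_1 x F_max] show ?thesis
    by (rule lam_pluripolar_subset)
qed

theorem mainTheorem10:
  fixes lam :: "real^'n" and I :: "'i set" and us :: "'i \<Rightarrow> complex^'n \<Rightarrow> ereal"
    and u :: "complex^'n \<Rightarrow> ereal" and S :: "(complex^'n) set"
  assumes lam_pos: "\<forall>k. lam$k > 0" and lam_one: "\<exists>k. lam$k = 1"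
    and I_ne: "I \<noteq> {}" and us_H: "\<forall>i\<in>I. us i \<in> H_lam lam"
    and u_def: "u = (\<lambda>z. SUP i\<in>I. us i z)"
    and S_def: "S = {z. u z < \<infinity>}"
  shows "((SUP z\<in>ball 0 1. u z) < \<infinity> \<longleftrightarrow> usc_reg u \<in> H_lam lam)
       \<and> (usc_reg u \<in> H_lam lam \<longleftrightarrow> (\<exists>a. usc_reg u a < \<infinity>))
       \<and> ((\<exists>a. usc_reg u a < \<infinity>) \<longleftrightarrow> (\<exists>a r. r > 0 \<and> (SUP z\<in>ball a r. u z) < \<infinity>))
       \<and> ((\<exists>a r. r > 0 \<and> (SUP z\<in>ball a r. u z) < \<infinity>) \<longleftrightarrow> \<not> lam_pluripolar lam S)"
    (is "(?bounded \<longleftrightarrow> ?in_H) \<and> (_ \<longleftrightarrow> ?finite) \<and> (_ \<longleftrightarrow> ?ball_bounded) \<and> (_ \<longleftrightarrow> ?not_polar)")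
proof -
  obtain f where f: "\<And>i. i \<in> I \<Longrightarrow> homogeneous_psh lam (f i)" "\<And>i. i \<in> I \<Longrightarrow> \<exists>z. f i z \<noteq> 0"
    and us: "\<And>i. i \<in> I \<Longrightarrow> us i = (\<lambda>z. ereal (f i z))"
    using us_H unfolding H_lam_iff by metis
  have u: "u = (\<lambda>z. SUP i\<in>I. ereal (f i z))" by (simp add: u_def us)
  have "?bounded \<Longrightarrow> ?in_H"
    unfolding u by (rule usc_reg_SUP_in_H_lam[OF lam_pos I_ne f])
  moreover have "?in_H \<Longrightarrow> ?finite"
    by (auto simp: H_lam_def psh_def)
  moreover have "?finite \<longleftrightarrow> ?ball_bounded"
    unfolding usc_reg_less_top_iff by blast
  moreover have "?ball_bounded \<Longrightarrow> ?not_polar"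
    unfolding S_def using not_lam_pluripolar_if_bounded_on_ball by blast
  moreover have "?not_polar \<Longrightarrow> ?bounded"
    unfolding S_def u using lam_pluripolar_if_unbounded[where f = f and I = I, OF lam_pos f(1)] by auto
  ultimately show ?thesis by blast
qed

end
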